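(* The assignment $\mathcal{E}_i\mapsto F_i+q^{\epsilon-1}E_{i-1}K_{-\alpha_{i-1}}$ ($i\in\mathbb{Z}$) extends to an injective $\mathbb{Q}(q)$-algebra homomorphism $j\colon \mathrm{El}_\epsilon\to U$. Its image $C=j(\mathrm{El}_\epsilon)$ is a right coideal subalgebra of $U$, i.e. $\Delta(C)\subseteq C\otimes U$; more precisely $\Delta(j(\mathcal{E}_i))=1\otimes j(\mathcal{E}_i)+j(\mathcal{E}_i)\otimes K_{\beta_i}$ for all $i\in\mathbb{Z}$.
   Context: $\mathbb{Q}(q)$ is the field of rational functions in $q$ over $\mathbb{Q}$; $[2]=q+q^{-1}$. Fix $\epsilon\in\{1,-1\}$. For $i,j\in\mathbb{Z}$ put $b_{ij}=-2$ if $j\in\{i,i+1\}$ and $b_{ij}=4\,\mathrm{sgn}(j-i)(-1)^{j-i}$ otherwise. The $q$-electrical algebra $\mathrm{El}_\epsilon$ is the $\mathbb{Q}(q)$-algebra generated by $\mathcal{E}_i$, $i\in\mathbb{Z}$, subject to: $\mathcal{E}_i\mathcal{E}_j=q^{b_{ij}}\mathcal{E}_j\mathcal{E}_i$ if $|i-j|>1$; $q^3\mathcal{E}_i^2\mathcal{E}_{i+1}-[2]\mathcal{E}_i\mathcal{E}_{i+1}\mathcal{E}_i+q^{-3}\mathcal{E}_{i+1}\mathcal{E}_i^2=-q^{\epsilon}[2]\mathcal{E}_i$; $q^{-3}\mathcal{E}_i^2\mathcal{E}_{i-1}-[2]\mathcal{E}_i\mathcal{E}_{i-1}\mathcal{E}_i+q^{3}\mathcal{E}_{i-1}\mathcal{E}_i^2=-q^{\epsilon}[2]\mathcal{E}_i$.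 Let $\mathfrak{h}_{\mathbb{Z}}$ be the free $\mathbb{Z}$-module with basis $e_i$, $i\in\mathbb{Z}$, $X=\mathrm{Hom}_{\mathbb{Z}}(\mathfrak{h}_{\mathbb{Z}},\mathbb{Z})$, $\langle\cdot,\cdot\rangle$ the evaluation, $\alpha_i^\vee=e_{i+1}-e_i$, $\varepsilon_i\in X$ with $\langle\varepsilon_i,e_j\rangle=\delta_{ij}$, $\alpha_i=\varepsilon_{i+1}-\varepsilon_i$. Define $\beta_i\in X$ by $\langle\beta_i,e_j\rangle=(-1)^i2$ if $j=i$, $=(-1)^i4$ if $j\ne i$ and $(-1)^jj>(-1)^ji$, and $=0$ otherwise; put $\gamma_i=-\beta_{i+1}$, and $\beta_{ij}=\langle\gamma_i-\alpha_i,\alpha_j^\vee\rangle$ (explicitly $0$ if $i=j$, $3(j-i)$ if $|i-j|=1$, $-4\,\mathrm{sgn}(j-i)(-1)^{j-i}$ otherwise). $U$ is the $\mathbb{Q}(q)$-algebra generated by $E_i,F_i$ ($i\in\mathbb{Z}$), $K_\lambda$ ($\lambda\in X$) subject to: $K_\lambda K_\mu=K_{\lambda+\mu}$, $K_0=1$; $K_\lambda F_i=q^{-\langle\lambda,\alpha_i^\vee\rangle}F_iK_\lambda$, $K_\lambda E_i=q^{\langle\lambda,\alpha_i^\vee\rangle}E_iK_\lambda$; $E_iF_j-q^{\beta_{ij}}F_jE_i=\delta_{ij}\frac{K_{\alpha_i}-K_{-\alpha_i}}{q-q^{-1}}$; $F_iF_j=q^{b_{ij}}F_jF_i$, $E_iE_j=q^{b_{ij}}E_jE_i$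 for $|i-j|>1$; $q^3F_i^2F_{i+1}-[2]F_iF_{i+1}F_i+q^{-3}F_{i+1}F_i^2=0$, $q^{-3}F_i^2F_{i-1}-[2]F_iF_{i-1}F_i+q^3F_{i-1}F_i^2=0$ and the same with $F$ replaced by $E$. $U$ is a Hopf algebra with comultiplication the algebra homomorphism $\Delta\colon U\to U\otimes U$ determined by $\Delta(F_i)=F_i\otimes K_{\beta_i}+1\otimes F_i$, $\Delta(E_i)=K_{\alpha_i}\otimes E_i+E_i\otimes K_{\alpha_i-\gamma_i}$, $\Delta(K_\lambda)=K_\lambda\otimes K_\lambda$. *)

theory Defs
  imports "HOL-Computational_Algebra.Polynomial" "HOL-Computational_Algebra.Fraction_Field"
begin

text \<open>An element of the free associative algebra on generators of type 'g with coefficients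
in 'k is a finitely supported function from words (lists of generators) to 'k.\<close>

definition nc_poly :: "('g list \<Rightarrow> 'k::comm_ring_1) \<Rightarrow> bool" where
  "nc_poly p \<longleftrightarrow> finite {w. p w \<noteq> 0}"

definition nc_zero :: "'g list \<Rightarrow> 'k::comm_ring_1" where
  "nc_zero = (\<lambda>w. 0)"

definition nc_one :: "'g list \<Rightarrow> 'k::comm_ring_1" where
  "nc_one = (\<lambda>w. if w = [] then 1 else 0)"

definition nc_gen :: "'g \<Rightarrow> 'g list \<Rightarrow> 'k::comm_ring_1" where
  "nc_gen g = (\<lambda>w. if w = [g] then 1 else 0)"

definition nc_add :: "('g list \<Rightarrow> 'k::comm_ring_1) \<Rightarrow> ('g list \<Rightarrow> 'k) \<Rightarrow> 'g list \<Rightarrow> 'k" where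
  "nc_add p q = (\<lambda>w. p w + q w)"

definition nc_diff :: "('g list \<Rightarrow> 'k::comm_ring_1) \<Rightarrow> ('g list \<Rightarrow> 'k) \<Rightarrow> 'g list \<Rightarrow> 'k" where
  "nc_diff p q = (\<lambda>w. p w - q w)"

definition nc_smult :: "'k::comm_ring_1 \<Rightarrow> ('g list \<Rightarrow> 'k) \<Rightarrow> 'g list \<Rightarrow> 'k" where
  "nc_smult c p = (\<lambda>w. c * p w)"

definition nc_mult :: "('g list \<Rightarrow> 'k::comm_ring_1) \<Rightarrow> ('g list \<Rightarrow> 'k) \<Rightarrow> 'g list \<Rightarrow> 'k" where
  "nc_mult p q = (\<lambda>w. \<Sum>k\<in>{0..length w}. p (take k w) * q (drop k w))"

definition nc_listprod :: "('g list \<Rightarrow> 'k::comm_ring_1) list \<Rightarrow> 'g list \<Rightarrow> 'k" where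
  "nc_listprod xs = foldr nc_mult xs nc_one"

definition nc_eval :: "('g \<Rightarrow> 'h list \<Rightarrow> 'k::comm_ring_1) \<Rightarrow> ('g list \<Rightarrow> 'k) \<Rightarrow> 'h list \<Rightarrow> 'k" where
  "nc_eval f p = (\<lambda>v. \<Sum>w\<in>{w. p w \<noteq> 0}. p w * nc_listprod (map f w) v)"

text \<open>Two-sided ideal generated by a set of relations R (scalars are absorbed in the
multiplication by constant polynomials).\<close>
inductive_set nc_ideal :: "('g list \<Rightarrow> 'k::comm_ring_1) set \<Rightarrow> ('g list \<Rightarrow> 'k) set"
  for R where
  zero: "nc_zero \<in> nc_ideal R"
| gen: "r \<in> R \<Longrightarrow> r \<in> nc_ideal R"
| add: "a \<in> nc_ideal R \<Longrightarrow> b \<in> nc_ideal R \<Longrightarrow> nc_add a b \<in> nc_ideal R"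
| mult: "a \<in> nc_ideal R \<Longrightarrow> nc_poly p \<Longrightarrow> nc_poly s \<Longrightarrow> nc_mult (nc_mult p a) s \<in> nc_ideal R"

definition nc_mult3 where "nc_mult3 a b c = nc_mult (nc_mult a b) c"

type_synonym qrat = "rat poly fract"

definition qq :: qrat where "qq = Fract [:0, 1:] 1"

definition qpow :: "int \<Rightarrow> qrat" where "qpow n = qq powi n"

definition qtwo :: qrat where "qtwo = qq + inverse qq"

definition serre_expr :: "int \<Rightarrow> ('g list \<Rightarrow> qrat) \<Rightarrow> ('g list \<Rightarrow> qrat) \<Rightarrow> 'g list \<Rightarrow> qrat" where
  "serre_expr c a b = nc_add (nc_diff (nc_smult (qpow c) (nc_mult3 a a b))
                                       (nc_smult qtwo (nc_mult3 a b a)))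
                             (nc_smult (qpow (- c)) (nc_mult3 b a a))"

text \<open>An element lambda of X = Hom(h_Z, Z) (h_Z free on e_i, i in Z) is identified with the
function j \<mapsto> <lambda, e_j>.\<close>
type_synonym weight = "int \<Rightarrow> int"

definition sgnpow :: "int \<Rightarrow> int" where "sgnpow i = (-1) ^ nat \<bar>i\<bar>"

definition alpha :: "int \<Rightarrow> weight" where
  "alpha i = (\<lambda>j. (if j = i + 1 then 1 else 0) - (if j = i then 1 else 0))"

text \<open><lambda, alpha_i^vee> with alpha_i^vee = e_{i+1} - e_i\<close>
definition pair_coroot :: "weight \<Rightarrow> int \<Rightarrow> int" where
  "pair_coroot l i = l (i + 1) - l i"

definition beta :: "int \<Rightarrow> weight" where
  "beta i = (\<lambda>j. if j = i then sgnpow i * 2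
                 else if sgnpow j * j > sgnpow j * i then sgnpow i * 4 else 0)"

definition gamma :: "int \<Rightarrow> weight" where
  "gamma i = (\<lambda>j. - beta (i + 1) j)"

definition betaij :: "int \<Rightarrow> int \<Rightarrow> int" where
  "betaij i j = pair_coroot (\<lambda>k. gamma i k - alpha i k) j"

definition bij :: "int \<Rightarrow> int \<Rightarrow> int" where
  "bij i j = (if j = i \<or> j = i + 1 then -2 else 4 * sgn (j - i) * sgnpow (j - i))"

datatype ugen = UE int | UF int | UK weight

type_synonym upoly = "ugen list \<Rightarrow> qrat"

abbreviation gE :: "int \<Rightarrow> upoly" where "gE i \<equiv> nc_gen (UE i)"
abbreviation gF :: "int \<Rightarrow> upoly" where "gF i \<equiv> nc_gen (UF i)"
abbreviation gK :: "weight \<Rightarrow> upoly" where "gK l \<equiv> nc_gen (UK l)"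

definition U_rels :: "upoly set" where
  "U_rels =
     {nc_diff (nc_mult (gK l) (gK m)) (gK (\<lambda>j. l j + m j)) | l m. True}
   \<union> {nc_diff (gK (\<lambda>j. 0)) nc_one}
   \<union> {nc_diff (nc_mult (gK l) (gF i)) (nc_smult (qpow (- pair_coroot l i)) (nc_mult (gF i) (gK l))) | l i. True}
   \<union> {nc_diff (nc_mult (gK l) (gE i)) (nc_smult (qpow (pair_coroot l i)) (nc_mult (gE i) (gK l))) | l i. True}
   \<union> {nc_diff (nc_diff (nc_mult (gE i) (gF j)) (nc_smult (qpow (betaij i j)) (nc_mult (gF j) (gE i))))
         (if i = j then nc_smult (inverse (qq - inverse qq)) (nc_diff (gK (alpha i)) (gK (\<lambda>k. - alpha i k)))
          else nc_zero) | i j. True}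
   \<union> {nc_diff (nc_mult (gF i) (gF j)) (nc_smult (qpow (bij i j)) (nc_mult (gF j) (gF i))) | i j. \<bar>i - j\<bar> > 1}
   \<union> {nc_diff (nc_mult (gE i) (gE j)) (nc_smult (qpow (bij i j)) (nc_mult (gE j) (gE i))) | i j. \<bar>i - j\<bar> > 1}
   \<union> {serre_expr 3 (gF i) (gF (i + 1)) | i. True}
   \<union> {serre_expr (-3) (gF i) (gF (i - 1)) | i. True}
   \<union> {serre_expr 3 (gE i) (gE (i + 1)) | i. True}
   \<union> {serre_expr (-3) (gE i) (gE (i - 1)) | i. True}"

type_synonym elpoly = "int list \<Rightarrow> qrat"

definition El_rels :: "int \<Rightarrow> elpoly set" where
  "El_rels eps =
     {nc_diff (nc_mult (nc_gen i) (nc_gen j)) (nc_smult (qpow (bij i j)) (nc_mult (nc_gen j) (nc_gen i)))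
       | i j. \<bar>i - j\<bar> > 1}
   \<union> {nc_add (serre_expr 3 (nc_gen i) (nc_gen (i + 1))) (nc_smult (qpow eps * qtwo) (nc_gen i)) | i. True}
   \<union> {nc_add (serre_expr (-3) (nc_gen i) (nc_gen (i - 1))) (nc_smult (qpow eps * qtwo) (nc_gen i)) | i. True}"

definition jgen :: "int \<Rightarrow> int \<Rightarrow> upoly" where
  "jgen eps i = nc_add (gF i)
                  (nc_smult (qpow (eps - 1)) (nc_mult (gE (i - 1)) (gK (\<lambda>k. - alpha (i - 1) k))))"

text \<open>U \<otimes> U is presented by generators Inl g (= g \<otimes> 1) and Inr g (= 1 \<otimes> g), the relations of U
on each copy, and commutation of the two copies.\<close>
type_synonym uupoly = "(ugen + ugen) list \<Rightarrow> qrat"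

definition tL :: "upoly \<Rightarrow> uupoly" where "tL = nc_eval (\<lambda>g. nc_gen (Inl g))"
definition tR :: "upoly \<Rightarrow> uupoly" where "tR = nc_eval (\<lambda>g. nc_gen (Inr g))"

definition UU_rels :: "uupoly set" where
  "UU_rels = tL ` U_rels \<union> tR ` U_rels
     \<union> {nc_diff (nc_mult (nc_gen (Inl a)) (nc_gen (Inr b))) (nc_mult (nc_gen (Inr b)) (nc_gen (Inl a)))
         | a b. True}"

fun Delta_gen :: "ugen \<Rightarrow> uupoly" where
  "Delta_gen (UF i) = nc_add (nc_mult (nc_gen (Inl (UF i))) (nc_gen (Inr (UK (beta i))))) (nc_gen (Inr (UF i)))"
| "Delta_gen (UE i) = nc_add (nc_mult (nc_gen (Inl (UK (alpha i)))) (nc_gen (Inr (UE i))))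
                             (nc_mult (nc_gen (Inl (UE i))) (nc_gen (Inr (UK (\<lambda>k. alpha i k - gamma i k)))))"
| "Delta_gen (UK l) = nc_mult (nc_gen (Inl (UK l))) (nc_gen (Inr (UK l)))"

definition Delta :: "upoly \<Rightarrow> uupoly" where "Delta = nc_eval Delta_gen"

text \<open>Representatives of the subspace C \<otimes> U of U \<otimes> U, where C = j(El_eps).\<close>
inductive_set CU :: "int \<Rightarrow> uupoly set" for eps where
  zero: "nc_zero \<in> CU eps"
| elem: "nc_poly a \<Longrightarrow> nc_poly u \<Longrightarrow> nc_mult (tL (nc_eval (jgen eps) a)) (tR u) \<in> CU eps"
| add: "x \<in> CU eps \<Longrightarrow> y \<in> CU eps \<Longrightarrow> nc_add x y \<in> CU eps"

end

theory Submission
  imports Defs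
begin

text \<open>
  Injectivity rests on leading terms. The free algebra on the F alone carries a Verma module structure
  of highest weight 0: F acts by left multiplication, K by weights and E is forced by its commutation
  rule with F and by killing the empty word. All relations of U hold there, except that those among the F
  hold only modulo the ideal J they generate, and every operator preserves J. Both facts come from
  the same observation: each relator among the F (respectively E) commutes up to a power of q
  with every E (respectively F). Hence if j(p) = 0 in U, then j(p) applied to the empty word lies in J.
  Since j of the i-th generator is multiplication by F_i plus an operator that lowers word length, the
  top component of that vector is the top component of p. The relations of El are those defining J
  up to terms of lower degree, so p can be replaced by an element of smaller degree, and induction on the
  degree gives p = 0 in El.

  The coideal property follows from the formula for the comultiplication of j on generators, because
  the subspace of U \<otimes> U spanned by products of j(El) \<otimes> 1 and 1 \<otimes> U is closed under multiplication
  by these elements.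
\<close>

section \<open>Noncommutative polynomials\<close>

text \<open>The overview takes for granted that j is well defined. The electrical Serre relations
  are checked in U by normal ordering: F to the left, then the elements E_i K_(-alpha_i), then K. In
  each relation all pairs to be exchanged q-commute except one with equal index, which produces a
  multiple of 1 - K_(-2 alpha_i); its K-part cancels in the Serre combination, and what survives is
  the linear term of the electrical relation. The argument for injectivity presupposes neither a
  triangular decomposition of U nor a basis of El: leading terms are read off in a free algebra,
  where words are linearly independent by construction. J is generated by homogeneous elements, so
  the components of its elements can be treated degree by degree, and this is what carries the top
  component of p back to El. Equations in U and U \<otimes> U are proved in quotient rings, where
  rewriting is possible; El enters only through its ideal, because its relators depend on
  \<open>eps\<close>.\<close>

definition nc_word :: "'g list \<Rightarrow> 'g list \<Rightarrow> 'k::comm_ring_1" where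
  "nc_word u = (\<lambda>w. if w = u then 1 else 0)"

lemma nc_one_eq_word: "nc_one = nc_word []"
  by (simp add: nc_one_def nc_word_def)

lemma nc_gen_eq_word: "nc_gen g = nc_word [g]"
  by (simp add: nc_gen_def nc_word_def)

lemma nc_mult_Nil: "nc_mult p q [] = p [] * q []"
  by (simp add: nc_mult_def)

text \<open>Peeling off the first letter turns the convolution over cut points into a recursion, so
  that later facts follow by induction on the word.\<close>

lemma nc_mult_Cons: "nc_mult p q (a # w) = p [] * q (a # w) + nc_mult (\<lambda>u. p (a # u)) q w"
  unfolding nc_mult_def length_Cons sum.atLeast0_atMost_Suc_shift by simp

lemma nc_mult_add_left: "nc_mult (nc_add p q) r = nc_add (nc_mult p r) (nc_mult q r)"
  by (simp add: nc_mult_def nc_add_def distrib_right sum.distrib)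

lemma nc_mult_add_right: "nc_mult p (nc_add q r) = nc_add (nc_mult p q) (nc_mult p r)"
  by (simp add: nc_mult_def nc_add_def distrib_left sum.distrib)

lemma nc_mult_diff_left: "nc_mult (nc_diff p q) r = nc_diff (nc_mult p r) (nc_mult q r)"
  by (simp add: nc_mult_def nc_diff_def left_diff_distrib sum_subtractf)

lemma nc_mult_diff_right: "nc_mult p (nc_diff q r) = nc_diff (nc_mult p q) (nc_mult p r)"
  by (simp add: nc_mult_def nc_diff_def right_diff_distrib sum_subtractf)

lemma nc_mult_smult_left: "nc_mult (nc_smult c p) q = nc_smult c (nc_mult p q)"
  by (simp add: nc_mult_def nc_smult_def sum_distrib_left mult.assoc)

lemma nc_mult_smult_right: "nc_mult p (nc_smult c q) = nc_smult c (nc_mult p q)"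
  by (simp add: nc_mult_def nc_smult_def sum_distrib_left mult.left_commute)

lemma nc_mult_zero_left: "nc_mult nc_zero q = nc_zero"
  by (simp add: nc_mult_def nc_zero_def)

lemma nc_mult_zero_right: "nc_mult p nc_zero = nc_zero"
  by (simp add: nc_mult_def nc_zero_def)

lemmas nc_mult_linear = nc_mult_add_left nc_mult_add_right nc_mult_diff_left nc_mult_diff_right
  nc_mult_smult_left nc_mult_smult_right nc_mult_zero_left nc_mult_zero_right

lemma nc_mult_assoc: "nc_mult (nc_mult p q) r = nc_mult p (nc_mult q r)"
proof
  show "nc_mult (nc_mult p q) r w = nc_mult p (nc_mult q r) w" for w
  proof (induction w arbitrary: p)
    case Nil
    then show ?case by (simp add: nc_mult_Nil mult.assoc)
  next
    case (Cons a w)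
    have "(\<lambda>u. nc_mult p q (a # u))
        = nc_add (nc_smult (p []) (\<lambda>u. q (a # u))) (nc_mult (\<lambda>u. p (a # u)) q)"
      by (simp add: nc_mult_Cons nc_add_def nc_smult_def)
    then have "nc_mult (nc_mult p q) r (a # w)
        = p [] * q [] * r (a # w) + p [] * nc_mult (\<lambda>u. q (a # u)) r w
          + nc_mult (\<lambda>u. p (a # u)) (nc_mult q r) w"
      by (simp add: nc_mult_Cons nc_mult_Nil nc_mult_linear Cons)
        (simp add: nc_add_def nc_smult_def Cons add.assoc)
    then show ?case
      by (simp add: nc_mult_Cons algebra_simps)
  qed
qed

lemma nc_mult_one_left: "nc_mult nc_one p = p"
proof
  show "nc_mult nc_one p w = p w" for w
    using nc_mult_zero_left[of p]
    by (cases w) (simp_all add: nc_mult_Nil nc_mult_Cons nc_one_def nc_zero_def fun_eq_iff)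
qed

lemma nc_mult_one_right: "nc_mult p nc_one = p"
proof
  show "nc_mult p nc_one w = p w" for w
    by (induction w arbitrary: p) (simp_all add: nc_mult_Nil nc_mult_Cons nc_one_def)
qed

lemma nc_gen_mult_Nil: "nc_mult (nc_gen g) p [] = 0"
  by (simp add: nc_mult_Nil nc_gen_def)

lemma nc_gen_mult_Cons:
  fixes p :: "'g list \<Rightarrow> 'k::comm_ring_1"
  shows "nc_mult (nc_gen g) p (a # w) = (if a = g then p w else 0)"
proof -
  have "(\<lambda>u. nc_gen g (a # u)) = (if a = g then nc_one else (nc_zero :: 'g list \<Rightarrow> 'k))"
    by (auto simp: nc_gen_def nc_one_def nc_zero_def)
  then show ?thesis
    by (simp add: nc_mult_Cons nc_gen_def nc_mult_one_left nc_mult_zero_left)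
      (simp add: nc_zero_def)
qed

lemma nc_gen_mult_word: "nc_mult (nc_gen g) (nc_word u) = nc_word (g # u)"
proof
  show "nc_mult (nc_gen g) (nc_word u) w = nc_word (g # u) w" for w
    by (cases w) (simp_all add: nc_gen_mult_Nil nc_gen_mult_Cons, simp_all add: nc_word_def)
qed

lemma nc_word_mult_word: "nc_mult (nc_word u) (nc_word v) = nc_word (u @ v)"
  by (induction u)
    (simp_all add: nc_one_eq_word[symmetric] nc_mult_one_left nc_gen_mult_word[symmetric]
      nc_mult_assoc)

lemma nc_poly_word [simp]: "nc_poly (nc_word u)"
  by (simp add: nc_poly_def nc_word_def)

lemma nc_poly_one [simp]: "nc_poly nc_one"
  by (simp add: nc_one_eq_word)

lemma nc_poly_gen [simp]: "nc_poly (nc_gen g)"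
  by (simp add: nc_gen_eq_word)

lemma nc_poly_zero [simp]: "nc_poly nc_zero"
  by (simp add: nc_poly_def nc_zero_def)

lemma nc_poly_add [simp]: "nc_poly p \<Longrightarrow> nc_poly q \<Longrightarrow> nc_poly (nc_add p q)"
  unfolding nc_poly_def nc_add_def
  by (rule finite_subset[of _ "{w. p w \<noteq> 0} \<union> {w. q w \<noteq> 0}"]) auto

lemma nc_poly_diff [simp]: "nc_poly p \<Longrightarrow> nc_poly q \<Longrightarrow> nc_poly (nc_diff p q)"
  unfolding nc_poly_def nc_diff_def
  by (rule finite_subset[of _ "{w. p w \<noteq> 0} \<union> {w. q w \<noteq> 0}"]) auto

lemma nc_poly_smult [simp]: "nc_poly p \<Longrightarrow> nc_poly (nc_smult c p)"
  unfolding nc_poly_def nc_smult_def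
  by (rule finite_subset[of _ "{w. p w \<noteq> 0}"]) auto

lemma nc_poly_mult [simp]:
  assumes "nc_poly p" "nc_poly q"
  shows "nc_poly (nc_mult p q)"
  unfolding nc_poly_def
proof (rule finite_subset)
  show "finite ((\<lambda>(u, v). u @ v) ` ({w. p w \<noteq> 0} \<times> {w. q w \<noteq> 0}))"
    using assms by (simp add: nc_poly_def)
  show "{w. nc_mult p q w \<noteq> 0} \<subseteq> (\<lambda>(u, v). u @ v) ` ({w. p w \<noteq> 0} \<times> {w. q w \<noteq> 0})"
  proof
    fix w assume "w \<in> {w. nc_mult p q w \<noteq> 0}"
    then obtain k where "p (take k w) * q (drop k w) \<noteq> 0"
      by (auto simp: nc_mult_def elim: sum.not_neutral_contains_not_neutral)
    then have "(take k w, drop k w) \<in> {w. p w \<noteq> 0} \<times> {w. q w \<noteq> 0}"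
      by auto
    then show "w \<in> (\<lambda>(u, v). u @ v) ` ({w. p w \<noteq> 0} \<times> {w. q w \<noteq> 0})"
      by (rule rev_image_eqI) simp
  qed
qed

lemma nc_poly_listprod [simp]: "(\<And>p. p \<in> set ps \<Longrightarrow> nc_poly p) \<Longrightarrow> nc_poly (nc_listprod ps)"
  by (induction ps) (simp_all add: nc_listprod_def)

lemma nc_poly_serre [simp]: "nc_poly a \<Longrightarrow> nc_poly b \<Longrightarrow> nc_poly (serre_expr c a b)"
  by (simp add: serre_expr_def nc_mult3_def)

lemma nc_poly_induct [consumes 1, case_names zero step]:
  assumes "nc_poly p" "P nc_zero"
    and "\<And>c w p. nc_poly p \<Longrightarrow> P p \<Longrightarrow> P (nc_add (nc_smult c (nc_word w)) p)"
  shows "P p"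
proof -
  have "finite {w. p w \<noteq> 0}" using assms(1) by (simp add: nc_poly_def)
  have "finite S \<Longrightarrow> {w. p w \<noteq> 0} \<subseteq> S \<Longrightarrow> P p" for S
  proof (induction S arbitrary: p rule: finite_induct)
    case empty
    then have "p = nc_zero" by (auto simp: nc_zero_def)
    then show ?case using assms(2) by simp
  next
    case (insert w S)
    define r where "r = p(w := 0)"
    have sub: "{v. r v \<noteq> 0} \<subseteq> S"
      using insert.prems by (auto simp: r_def)
    have "nc_poly r"
      unfolding nc_poly_def using sub insert.hyps(1) by (rule finite_subset)
    then have "P (nc_add (nc_smult (p w) (nc_word w)) r)"
      using sub by (intro assms(3) insert.IH)
    moreover have "nc_add (nc_smult (p w) (nc_word w)) r = p"
      by (auto simp: nc_add_def nc_smult_def nc_word_def r_def)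
    ultimately show ?case by simp
  qed
  from this[OF \<open>finite {w. p w \<noteq> 0}\<close> order_refl] show ?thesis .
qed

section \<open>Two-sided ideals and linear arithmetic of polynomials\<close>

lemma nc_ideal_poly: "a \<in> nc_ideal R \<Longrightarrow> (\<And>r. r \<in> R \<Longrightarrow> nc_poly r) \<Longrightarrow> nc_poly a"
  by (induction rule: nc_ideal.induct) auto

lemma nc_ideal_mult_left: "a \<in> nc_ideal R \<Longrightarrow> nc_poly p \<Longrightarrow> nc_mult p a \<in> nc_ideal R"
  using nc_ideal.mult[of a R p nc_one] by (simp add: nc_mult_one_right)

lemma nc_ideal_mult_right: "a \<in> nc_ideal R \<Longrightarrow> nc_poly p \<Longrightarrow> nc_mult a p \<in> nc_ideal R"
  using nc_ideal.mult[of a R nc_one p] by (simp add: nc_mult_one_left)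

lemma nc_ideal_smult: "a \<in> nc_ideal R \<Longrightarrow> nc_smult c a \<in> nc_ideal R"
  using nc_ideal_mult_left[of a R "nc_smult c nc_one"]
  by (simp add: nc_mult_smult_left nc_mult_one_left)

lemma nc_diff_conv_add: "nc_diff p q = nc_add p (nc_smult (-1) q)"
  by (simp add: nc_diff_def nc_add_def nc_smult_def)

lemma nc_add_assoc: "nc_add (nc_add p q) r = nc_add p (nc_add q r)"
  by (simp add: nc_add_def add.assoc)

lemma nc_add_commute: "nc_add p q = nc_add q p"
  by (simp add: nc_add_def add.commute)

lemma nc_add_zero_left: "nc_add nc_zero p = p"
  by (simp add: nc_add_def nc_zero_def)

lemma nc_add_uminus_left: "nc_add (nc_smult (-1) p) p = nc_zero"
  by (simp add: nc_add_def nc_zero_def nc_smult_def)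

lemma nc_diff_zero_right: "nc_diff p nc_zero = p"
  by (simp add: nc_diff_def nc_zero_def)

lemma nc_smult_add: "nc_smult c (nc_add p q) = nc_add (nc_smult c p) (nc_smult c q)"
  by (simp add: nc_add_def nc_smult_def distrib_left)

lemma nc_smult_diff: "nc_smult c (nc_diff p q) = nc_diff (nc_smult c p) (nc_smult c q)"
  by (simp add: nc_diff_def nc_smult_def right_diff_distrib)

lemma nc_smult_add_scalar: "nc_smult (c + d) p = nc_add (nc_smult c p) (nc_smult d p)"
  by (simp add: nc_add_def nc_smult_def distrib_right)

lemma nc_smult_smult: "nc_smult c (nc_smult d p) = nc_smult (c * d) p"
  by (simp add: nc_smult_def mult.assoc)

lemma nc_smult_one: "nc_smult 1 p = p"
  by (simp add: nc_smult_def)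

lemma nc_ideal_diff: "a \<in> nc_ideal R \<Longrightarrow> b \<in> nc_ideal R \<Longrightarrow> nc_diff a b \<in> nc_ideal R"
  by (simp add: nc_diff_conv_add nc_ideal.add nc_ideal_smult)

section \<open>Algebras presented by generators and relators\<close>

text \<open>Attaching the relators to the type of generators makes the presented algebra a type
  depending on that type alone, so that ring classes can be instantiated once for all presentations
  used.\<close>

class presented =
  fixes relators :: "('a list \<Rightarrow> qrat) set"
  assumes nc_poly_relators: "r \<in> relators \<Longrightarrow> nc_poly r"

definition nc_cong :: "('g::presented list \<Rightarrow> qrat) \<Rightarrow> ('g list \<Rightarrow> qrat) \<Rightarrow> bool" where
  "nc_cong p q \<longleftrightarrow> nc_poly p \<and> nc_poly q \<and> nc_diff p q \<in> nc_ideal relators"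

lemma nc_cong_refl: "nc_poly p \<Longrightarrow> nc_cong p p"
  using nc_ideal.zero[of relators]
  by (simp add: nc_cong_def nc_diff_def nc_zero_def)

lemma nc_cong_sym: "nc_cong p q \<Longrightarrow> nc_cong q p"
  using nc_ideal_smult[of "nc_diff p q" relators "-1"]
  by (simp add: nc_cong_def nc_diff_def nc_smult_def)

lemma nc_cong_trans: "nc_cong p q \<Longrightarrow> nc_cong q r \<Longrightarrow> nc_cong p r"
  using nc_ideal.add[of "nc_diff p q" relators "nc_diff q r"]
  by (simp add: nc_cong_def nc_diff_def nc_add_def)

lemma nc_cong_self [simp]: "nc_cong p p \<longleftrightarrow> nc_poly p"
  using nc_cong_refl nc_cong_def by blast

\<comment> \<open>The equivalence is partial because the ideal is closed only under multiplication
  by finitely supported functions; other functions represent nothing.\<close>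
quotient_type (overloaded) 'g palg = "'g::presented list \<Rightarrow> qrat" / partial: nc_cong
  morphisms rep_palg cls
proof (rule part_equivpI)
  show "\<exists>p. nc_cong p p" using nc_cong_refl nc_poly_zero by blast
  show "symp nc_cong" by (rule sympI) (rule nc_cong_sym)
  show "transp nc_cong" by (rule transpI) (rule nc_cong_trans)
qed

text \<open>The quotient may be trivial, so the class \<open>ring_1\<close>, which demands \<open>0 \<noteq> 1\<close>, is not available;
\<open>ring\<close> and \<open>monoid_mult\<close> are instantiated separately.\<close>

instantiation palg :: (presented) ring
begin

lift_definition zero_palg :: "'a palg" is nc_zero by (rule nc_cong_refl) simp

lift_definition plus_palg :: "'a palg \<Rightarrow> 'a palg \<Rightarrow> 'a palg" is nc_add
proof -
  fix p p' q q' :: "'a list \<Rightarrow> qrat"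
  assume "nc_cong p p'" "nc_cong q q'"
  moreover have "nc_diff (nc_add p q) (nc_add p' q') = nc_add (nc_diff p p') (nc_diff q q')"
    by (simp add: nc_diff_def nc_add_def algebra_simps)
  ultimately show "nc_cong (nc_add p q) (nc_add p' q')"
    by (simp add: nc_cong_def nc_ideal.add)
qed

lift_definition minus_palg :: "'a palg \<Rightarrow> 'a palg \<Rightarrow> 'a palg" is nc_diff
proof -
  fix p p' q q' :: "'a list \<Rightarrow> qrat"
  assume "nc_cong p p'" "nc_cong q q'"
  moreover have "nc_diff (nc_diff p q) (nc_diff p' q') = nc_diff (nc_diff p p') (nc_diff q q')"
    by (simp add: nc_diff_def algebra_simps)
  ultimately show "nc_cong (nc_diff p q) (nc_diff p' q')"
    by (simp add: nc_cong_def nc_ideal_diff)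
qed

lift_definition uminus_palg :: "'a palg \<Rightarrow> 'a palg" is "nc_smult (-1)"
proof -
  fix p p' :: "'a list \<Rightarrow> qrat"
  assume "nc_cong p p'"
  moreover have "nc_diff (nc_smult (-1) p) (nc_smult (-1) p') = nc_smult (-1) (nc_diff p p')"
    by (simp add: nc_diff_def nc_smult_def algebra_simps)
  ultimately show "nc_cong (nc_smult (-1) p) (nc_smult (-1) p')"
    by (simp add: nc_cong_def nc_ideal_smult)
qed

lift_definition times_palg :: "'a palg \<Rightarrow> 'a palg \<Rightarrow> 'a palg" is nc_mult
proof -
  fix p p' q q' :: "'a list \<Rightarrow> qrat"
  assume "nc_cong p p'" "nc_cong q q'"
  moreover have "nc_diff (nc_mult p q) (nc_mult p' q')
      = nc_add (nc_mult (nc_diff p p') q) (nc_mult p' (nc_diff q q'))"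
    by (simp add: nc_mult_linear) (simp add: nc_diff_def nc_add_def)
  ultimately show "nc_cong (nc_mult p q) (nc_mult p' q')"
    by (simp add: nc_cong_def nc_ideal.add nc_ideal_mult_left nc_ideal_mult_right)
qed

instance
proof
  fix x y z :: "'a palg"
  show "x * y * z = x * (y * z)"
    by transfer (simp add: nc_mult_assoc)
  show "(x + y) * z = x * z + y * z" "x * (y + z) = x * y + x * z"
    by (transfer; simp add: nc_mult_linear)+
  show "x + y + z = x + (y + z)"
    by transfer (simp add: nc_add_assoc)
  show "x + y = y + x"
    by transfer (subst nc_add_commute, simp)
  show "0 + x = x"
    by transfer (simp add: nc_add_zero_left)
  show "- x + x = 0"
    by transfer (simp add: nc_add_uminus_left)
  show "x - y = x + - y"
    by transfer (simp add: nc_diff_conv_add)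
qed

end

instantiation palg :: (presented) monoid_mult
begin

lift_definition one_palg :: "'a palg" is nc_one by simp

instance
proof
  fix x :: "'a palg"
  show "1 * x = x" by transfer (simp add: nc_mult_one_left)
  show "x * 1 = x" by transfer (simp add: nc_mult_one_right)
qed

end

lemma cls_zero: "cls nc_zero = 0"
  by (simp add: zero_palg.abs_eq)

lemma cls_one: "cls nc_one = 1"
  by (simp add: one_palg.abs_eq)

lemma cls_add: "nc_poly p \<Longrightarrow> nc_poly q \<Longrightarrow> cls (nc_add p q) = cls p + cls q"
  by (simp add: plus_palg.abs_eq)

lemma cls_diff: "nc_poly p \<Longrightarrow> nc_poly q \<Longrightarrow> cls (nc_diff p q) = cls p - cls q"
  by (simp add: minus_palg.abs_eq)

lemma cls_mult: "nc_poly p \<Longrightarrow> nc_poly q \<Longrightarrow> cls (nc_mult p q) = cls p * cls q"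
  by (simp add: times_palg.abs_eq)

lemma cls_eq_zero_iff:
  assumes "nc_poly p"
  shows "cls p = 0 \<longleftrightarrow> p \<in> nc_ideal relators"
proof -
  have "cls p = 0 \<longleftrightarrow> nc_cong p nc_zero"
    using assms by (simp add: zero_palg_def Quotient3_rel[OF Quotient3_palg, symmetric])
  also have "\<dots> \<longleftrightarrow> p \<in> nc_ideal relators"
    using assms by (simp add: nc_cong_def nc_diff_zero_right)
  finally show ?thesis .
qed

lemma cls_relator: "r \<in> relators \<Longrightarrow> cls r = 0"
  by (simp add: cls_eq_zero_iff nc_poly_relators nc_ideal.gen)

lemma cls_surj: "\<exists>p. nc_poly p \<and> x = cls p"
  using Quotient3_abs_rep[OF Quotient3_palg, of x] Quotient3_rep_reflp[OF Quotient3_palg, of x]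
  by (metis nc_cong_self)

text \<open>Scalars act as multiplication by constant polynomials, so most module laws come from the
  ring laws; centrality is \<open>scl_mult_right\<close>.\<close>

definition scl :: "qrat \<Rightarrow> 'g::presented palg \<Rightarrow> 'g palg" where
  "scl c x = cls (nc_smult c nc_one) * x"

lemma cls_smult: "nc_poly p \<Longrightarrow> cls (nc_smult c p) = scl c (cls p)"
  by (simp add: scl_def cls_mult[symmetric] nc_mult_linear nc_mult_one_left)

lemmas cls_simps = cls_zero cls_one cls_add cls_diff cls_mult cls_smult

lemma scl_add_right: "scl c (x + y) = scl c x + scl c y"
  by (simp add: scl_def distrib_left)

lemma scl_diff_right: "scl c (x - y) = scl c x - scl c y"
  by (simp add: scl_def right_diff_distrib)

lemma scl_add_left: "scl (c + d) x = scl c x + scl d x"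
  by (simp add: scl_def nc_smult_add_scalar cls_add distrib_right)

lemma scl_scl: "scl c (scl d x) = scl (c * d) x"
  by (simp add: scl_def mult.assoc[symmetric] cls_mult[symmetric] nc_mult_linear
      nc_mult_one_left nc_smult_smult mult.commute)

lemma scl_one: "scl 1 x = x"
  by (simp add: scl_def nc_smult_one cls_one)

lemma scl_mult_left: "scl c x * y = scl c (x * y)"
  by (simp add: scl_def mult.assoc)

lemma scl_mult_right: "x * scl c y = scl c (x * y)"
proof -
  obtain p where p: "nc_poly p" "x = cls p" using cls_surj by blast
  then have "x * cls (nc_smult c nc_one) = cls (nc_smult c nc_one) * x"
    by (simp add: cls_mult[symmetric] nc_mult_linear nc_mult_one_left nc_mult_one_right)
  then show ?thesis
    by (simp add: scl_def mult.assoc[symmetric])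
qed

lemma scl_zero_right: "scl c 0 = 0"
  using scl_add_right[of c 0 0] by simp

lemma scl_zero_left: "scl 0 x = 0"
  using scl_add_left[of 0 0 x] by simp

lemma scl_minus_right: "scl c (- x) = - scl c x"
  using scl_diff_right[of c 0 x] by (simp add: scl_zero_right)

lemma scl_minus_left: "scl (- c) x = - scl c x"
  using scl_add_left[of "-c" c x] by (simp add: scl_zero_left eq_neg_iff_add_eq_0)

section \<open>Homomorphisms from the free algebra to a presented algebra\<close>

definition ev :: "('g \<Rightarrow> 'h::presented palg) \<Rightarrow> ('g list \<Rightarrow> qrat) \<Rightarrow> 'h palg" where
  "ev g p = (\<Sum>w\<in>{w. p w \<noteq> 0}. scl (p w) (prod_list (map g w)))"

lemma ev_superset:
  "finite S \<Longrightarrow> {w. p w \<noteq> 0} \<subseteq> S \<Longrightarrow> ev g p = (\<Sum>w\<in>S. scl (p w) (prod_list (map g w)))"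
  unfolding ev_def by (rule sum.mono_neutral_left) (auto simp: scl_zero_left)

lemma ev_zero: "ev g nc_zero = 0"
  by (simp add: ev_def nc_zero_def)

lemma ev_word: "ev g (nc_word w) = prod_list (map g w)"
  by (subst ev_superset[of "{w}"]) (auto simp: nc_word_def scl_one)

lemma ev_one: "ev g nc_one = 1"
  by (simp add: nc_one_eq_word ev_word)

lemma ev_gen: "ev g (nc_gen x) = g x"
  by (simp add: nc_gen_eq_word ev_word)

lemma ev_add:
  assumes "nc_poly p" "nc_poly q"
  shows "ev g (nc_add p q) = ev g p + ev g q"
proof -
  let ?S = "{w. p w \<noteq> 0} \<union> {w. q w \<noteq> 0}"
  have fin: "finite ?S" using assms by (simp add: nc_poly_def)
  have "ev g (nc_add p q) = (\<Sum>w\<in>?S. scl (p w + q w) (prod_list (map g w)))"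
    using fin by (subst ev_superset[of ?S]) (auto simp: nc_add_def)
  also have "\<dots> = ev g p + ev g q"
    using fin by (simp add: ev_superset[of ?S p] ev_superset[of ?S q] scl_add_left sum.distrib)
  finally show ?thesis .
qed

lemma ev_smult:
  assumes "nc_poly p"
  shows "ev g (nc_smult c p) = scl c (ev g p)"
proof -
  let ?S = "{w. p w \<noteq> 0}"
  have fin: "finite ?S" using assms by (simp add: nc_poly_def)
  have scl_sum: "scl c (\<Sum>w\<in>A. f w) = (\<Sum>w\<in>A. scl c (f w))" for A and f :: "'a list \<Rightarrow> 'b palg"
    by (induction A rule: infinite_finite_induct) (simp_all add: scl_zero_right scl_add_right)
  have "ev g (nc_smult c p) = (\<Sum>w\<in>?S. scl (c * p w) (prod_list (map g w)))"
    using fin by (subst ev_superset[of ?S]) (auto simp: nc_smult_def)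
  also have "\<dots> = scl c (ev g p)"
    by (simp add: ev_def scl_sum scl_scl)
  finally show ?thesis .
qed

lemma ev_diff: "nc_poly p \<Longrightarrow> nc_poly q \<Longrightarrow> ev g (nc_diff p q) = ev g p - ev g q"
  by (simp add: nc_diff_conv_add ev_add ev_smult scl_minus_left scl_one)

lemma ev_mult:
  assumes "nc_poly p" "nc_poly q"
  shows "ev g (nc_mult p q) = ev g p * ev g q"
proof -
  have "ev g (nc_mult (nc_word u) q) = prod_list (map g u) * ev g q" for u
    using assms(2)
    by (induction q rule: nc_poly_induct)
      (simp_all add: nc_mult_linear ev_zero ev_add ev_smult ev_word nc_word_mult_word
        distrib_left scl_mult_right)
  note ev_word_mult = this
  show ?thesis
    using assms(1)
    by (induction p rule: nc_poly_induct)
      (simp_all add: assms(2) ev_word_mult nc_mult_linear ev_zero ev_add ev_smult ev_word distrib_right scl_mult_left)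
qed

lemmas ev_simps = ev_zero ev_one ev_gen ev_add ev_smult ev_diff ev_mult

lemma ev_listprod:
  "(\<And>p. p \<in> set ps \<Longrightarrow> nc_poly p) \<Longrightarrow> ev g (nc_listprod ps) = prod_list (map (ev g) ps)"
proof (induction ps)
  case (Cons p ps)
  then show ?case
    using nc_poly_listprod[of ps] by (simp add: nc_listprod_def ev_mult)
qed (simp add: nc_listprod_def ev_one)

lemma ev_serre:
  "nc_poly a \<Longrightarrow> nc_poly b \<Longrightarrow> ev g (serre_expr c a b) =
    scl (qpow c) (ev g a * ev g a * ev g b) - scl qtwo (ev g a * ev g b * ev g a)
      + scl (qpow (- c)) (ev g b * ev g a * ev g a)"
  by (simp add: serre_expr_def nc_mult3_def ev_simps)

text \<open>The quotient map is itself an evaluation; the class of a substituted polynomial can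
  therefore be computed from the classes of the substituted generators.\<close>

lemma cls_eq_ev: "nc_poly p \<Longrightarrow> cls p = ev (\<lambda>x. cls (nc_gen x)) p"
proof (induction p rule: nc_poly_induct)
  case (step c w p)
  have "cls (nc_word w) = prod_list (map (\<lambda>x. cls (nc_gen x)) w)"
    by (induction w)
      (simp_all add: nc_one_eq_word[symmetric] cls_one nc_gen_mult_word[symmetric] cls_mult)
  with step show ?case by (simp add: cls_simps ev_simps ev_word)
qed (simp add: cls_zero ev_zero)

text \<open>The set \<open>R\<close> is arbitrary because the relators of El vary with
  \<open>eps\<close> and are not attached to a type.\<close>

lemma ev_nc_ideal:
  assumes "p \<in> nc_ideal R" "\<And>r. r \<in> R \<Longrightarrow> nc_poly r" "\<And>r. r \<in> R \<Longrightarrow> ev g r = 0"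
  shows "ev g p = 0"
  using assms(1)
  by (induction rule: nc_ideal.induct)
    (simp_all add: ev_simps assms(2,3) nc_ideal_poly[where R = R])

text \<open>Linear extension with values in functions on words rather than in a quotient. Both
  \<open>nc_eval\<close> and the action on the Verma module are instances.\<close>

definition lin_ext :: "('g list \<Rightarrow> 'h list \<Rightarrow> 'k) \<Rightarrow> ('g list \<Rightarrow> 'k::comm_ring_1) \<Rightarrow> 'h list \<Rightarrow> 'k" where
  "lin_ext X p = (\<lambda>v. \<Sum>w\<in>{w. p w \<noteq> 0}. p w * X w v)"

lemma lin_ext_superset:
  "finite S \<Longrightarrow> {w. p w \<noteq> 0} \<subseteq> S \<Longrightarrow> lin_ext X p = (\<lambda>v. \<Sum>w\<in>S. p w * X w v)"
  unfolding lin_ext_def by (rule ext, rule sum.mono_neutral_left) auto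

lemma lin_ext_zero: "lin_ext X nc_zero = nc_zero"
  by (simp add: lin_ext_def nc_zero_def)

lemma lin_ext_word: "lin_ext X (nc_word w) = X w"
  by (subst lin_ext_superset[of "{w}"]) (auto simp: nc_word_def)

lemma lin_ext_add:
  assumes "nc_poly p" "nc_poly q"
  shows "lin_ext X (nc_add p q) = nc_add (lin_ext X p) (lin_ext X q)"
proof -
  let ?S = "{w. p w \<noteq> 0} \<union> {w. q w \<noteq> 0}"
  have fin: "finite ?S" using assms by (simp add: nc_poly_def)
  have "lin_ext X (nc_add p q) = (\<lambda>v. \<Sum>w\<in>?S. (p w + q w) * X w v)"
    using fin by (subst lin_ext_superset[of ?S]) (auto simp: nc_add_def)
  also have "\<dots> = nc_add (lin_ext X p) (lin_ext X q)"
    using fin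
    by (simp add: lin_ext_superset[of ?S p] lin_ext_superset[of ?S q] nc_add_def distrib_right sum.distrib)
  finally show ?thesis .
qed

lemma lin_ext_smult:
  assumes "nc_poly p"
  shows "lin_ext X (nc_smult c p) = nc_smult c (lin_ext X p)"
proof -
  let ?S = "{w. p w \<noteq> 0}"
  have fin: "finite ?S" using assms by (simp add: nc_poly_def)
  have "lin_ext X (nc_smult c p) = (\<lambda>v. \<Sum>w\<in>?S. c * p w * X w v)"
    using fin by (subst lin_ext_superset[of ?S]) (auto simp: nc_smult_def)
  also have "\<dots> = nc_smult c (lin_ext X p)"
    by (simp add: lin_ext_def nc_smult_def sum_distrib_left mult.assoc)
  finally show ?thesis .
qed

lemmas lin_ext_simps = lin_ext_zero lin_ext_word lin_ext_add lin_ext_smult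

lemma nc_eval_eq_lin_ext: "nc_eval f = lin_ext (\<lambda>w. nc_listprod (map f w))"
  by (simp add: nc_eval_def lin_ext_def fun_eq_iff)

lemma nc_eval_step:
  "nc_poly p \<Longrightarrow> nc_eval f (nc_add (nc_smult c (nc_word w)) p)
    = nc_add (nc_smult c (nc_listprod (map f w))) (nc_eval f p)"
  by (simp add: nc_eval_eq_lin_ext lin_ext_simps)

lemma nc_eval_diff:
  "nc_poly p \<Longrightarrow> nc_poly q \<Longrightarrow> nc_eval f (nc_diff p q) = nc_diff (nc_eval f p) (nc_eval f q)"
  by (simp add: nc_diff_conv_add nc_eval_eq_lin_ext lin_ext_simps)

lemma nc_eval_zero: "nc_eval f nc_zero = nc_zero"
  by (simp add: nc_eval_def nc_zero_def)

lemma nc_poly_eval [simp]: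
  "nc_poly p \<Longrightarrow> (\<And>x. nc_poly (f x)) \<Longrightarrow> nc_poly (nc_eval f p)"
  by (induction p rule: nc_poly_induct)
    (auto simp: nc_eval_zero nc_eval_step intro!: nc_poly_add nc_poly_smult nc_poly_listprod)

lemma ev_nc_eval:
  "nc_poly p \<Longrightarrow> (\<And>x. nc_poly (f x)) \<Longrightarrow> ev g (nc_eval f p) = ev (\<lambda>x. ev g (f x)) p"
proof (induction p rule: nc_poly_induct)
  case (step c w p)
  have "ev g (nc_listprod (map f w)) = prod_list (map (\<lambda>x. ev g (f x)) w)"
    using step.prems by (subst ev_listprod) (auto simp: comp_def)
  moreover have "nc_poly (nc_listprod (map f w))"
    using step.prems by (intro nc_poly_listprod) auto
  ultimately show ?case
    using step by (simp add: nc_eval_step ev_simps ev_word)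
qed (simp add: nc_eval_zero ev_zero)

section \<open>Powers of q\<close>

lemma qq_nonzero: "qq \<noteq> 0"
  by (simp add: qq_def Zero_fract_def eq_fract)

lemma qpow_zero: "qpow 0 = 1"
  by (simp add: qpow_def)

lemma qpow_add: "qpow (m + n) = qpow m * qpow n"
  by (simp add: qpow_def power_int_add qq_nonzero)

lemma qtwo_eq: "qtwo = qpow 1 + qpow (- 1)"
  by (simp add: qtwo_def qpow_def power_int_minus)

text \<open>As q is an indeterminate, q^2 = 1 fails. This makes the denominator in the relation
  between E_i and F_i cancellable.\<close>

lemma qpow_diff_nonzero: "qpow 1 - qpow (- 1) \<noteq> 0"
proof
  assume "qpow 1 - qpow (- 1) = 0"
  then have "qpow 1 * qpow 1 = qpow 1 * qpow (- 1)" by simp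
  then have "qq * qq = 1" by (simp add: qpow_add[symmetric] qpow_zero) (simp add: qpow_def power2_eq_square)
  then have "Fract [:0, 1:] 1 * Fract [:0, 1:] 1 = (Fract 1 1 :: qrat)"
    by (simp add: qq_def One_fract_def)
  then show False by (simp add: eq_fract one_pCons)
qed

lemma scl_qpow_scl_qpow: "scl (qpow m) (scl (qpow n) x) = scl (qpow (m + n)) x"
  by (simp add: scl_scl qpow_add)

lemma scl_qpow_zero: "scl (qpow 0) x = x"
  by (simp add: qpow_zero scl_one)

lemma scl_commute: "scl c (scl d x) = scl d (scl c x)"
  by (simp add: scl_scl mult.commute)

section \<open>Normal ordering and the electrical Serre computation\<close>

lemmas palg_linear = mult.assoc distrib_left distrib_right left_diff_distrib right_diff_distrib
  scl_mult_left scl_mult_right scl_add_right scl_diff_right scl_minus_right scl_zero_right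
  scl_qpow_scl_qpow scl_qpow_zero qpow_zero scl_one

text \<open>Solved for a a b, the relation becomes a rewrite rule. Splitting [2] into q and its
  inverse leaves powers of q as the only coefficients, and these merge by adding exponents.\<close>

lemma serre_rewrite:
  assumes "scl (qpow c) (a * a * b) - scl qtwo (a * b * a) + scl (qpow (- c)) (b * a * a) = 0"
  shows "a * (a * b) = scl (qpow (1 - c)) (a * (b * a)) + scl (qpow (- c - 1)) (a * (b * a))
    - scl (qpow (- 2 * c)) (b * (a * a))"
proof -
  have "scl (qpow (- c)) (scl (qpow c) (a * a * b) - scl qtwo (a * b * a) + scl (qpow (- c)) (b * a * a)) = 0"
    using assms by (simp add: scl_zero_right)
  then show ?thesis
    by (simp add: palg_linear qtwo_eq scl_add_left) (simp add: algebra_simps)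
qed

lemma swap_rewrite: "y * a = r \<Longrightarrow> y * (a * z) = r * z"
  for y a z :: "'g::presented palg"
  by (simp add: mult.assoc[symmetric])

text \<open>Applied with \<open>a = F_i\<close>, \<open>b = F_(i + 1)\<close> and \<open>x\<close>, \<open>y\<close> the multiples of
\<open>E_(i - 1) K_(-alpha_(i - 1))\<close>, \<open>E_i K_(-alpha_i)\<close> in j, with \<open>L = K_(-2 alpha_i)\<close>.
The inhomogeneous term stems from the failure of \<open>y\<close> and \<open>a\<close> to q-commute.\<close>

lemma electrical_serre_up:
  fixes a b x y L :: "'g::presented palg"
  assumes ab: "scl (qpow 3) (a * a * b) - scl qtwo (a * b * a) + scl (qpow (- 3)) (b * a * a) = 0"
    and xy: "scl (qpow 3) (x * x * y) - scl qtwo (x * y * x) + scl (qpow (- 3)) (y * x * x) = 0"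
    and xa: "x * a = scl (qpow 2) (a * x)"
    and xb: "x * b = scl (qpow (- 4)) (b * x)"
    and yb: "y * b = scl (qpow 2) (b * y)"
    and ya: "y * a = scl (qpow 2) (a * y) + scl t (1 - L)"
    and La: "L * a = scl (qpow 4) (a * L)"
    and Lx: "L * x = scl (qpow 2) (x * L)"
  shows "scl (qpow 3) ((a + x) * (a + x) * (b + y)) - scl qtwo ((a + x) * (b + y) * (a + x))
      + scl (qpow (- 3)) ((b + y) * (a + x) * (a + x))
      = scl t (scl (qpow (- 3)) (a + x) - scl (qpow 1) (a + x))"
proof -
  \<comment> \<open>Normal order: a, b before x, y before L. Since b + y occurs once in each term,
    an L created by moving y past a meets just one further factor, either a or x.\<close>
  note swaps = xa xb yb ya La Lx
  note swaps' = swaps[THEN swap_rewrite]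
  have tq: "scl t (scl (qpow n) z) = scl (qpow n) (scl t z)" for n z
    by (rule scl_commute)
  show ?thesis
    by (simp add: palg_linear scl_add_left qtwo_eq swaps swaps' tq
       serre_rewrite[OF ab, simplified] serre_rewrite[OF xy, simplified])
qed

text \<open>Here \<open>b = F_(i - 1)\<close> and \<open>y\<close> comes from \<open>E_(i - 2)\<close>, so that the exceptional pair
is \<open>x\<close>, \<open>b\<close>.\<close>

lemma electrical_serre_down:
  fixes a b x y L :: "'g::presented palg"
  assumes ab: "scl (qpow (- 3)) (a * a * b) - scl qtwo (a * b * a) + scl (qpow 3) (b * a * a) = 0"
    and xy: "scl (qpow (- 3)) (x * x * y) - scl qtwo (x * y * x) + scl (qpow 3) (y * x * x) = 0"
    and xa: "x * a = scl (qpow 2) (a * x)"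
    and xb: "x * b = scl (qpow 2) (b * x) + scl t (1 - L)"
    and yb: "y * b = scl (qpow 2) (b * y)"
    and ya: "y * a = scl (qpow (- 4)) (a * y)"
    and La: "L * a = scl (qpow (- 2)) (a * L)"
    and Lx: "L * x = scl (qpow (- 4)) (x * L)"
  shows "scl (qpow (- 3)) ((a + x) * (a + x) * (b + y)) - scl qtwo ((a + x) * (b + y) * (a + x))
      + scl (qpow 3) ((b + y) * (a + x) * (a + x))
      = scl t (scl (qpow (- 3)) (a + x) - scl (qpow 1) (a + x))"
proof -
  note swaps = xa xb yb ya La Lx
  note swaps' = swaps[THEN swap_rewrite]
  have tq: "scl t (scl (qpow n) z) = scl (qpow n) (scl t z)" for n z
    by (rule scl_commute)
  show ?thesis
    by (simp add: palg_linear scl_add_left qtwo_eq swaps swaps' tq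
       serre_rewrite[where c = "- 3", simplified, OF ab] serre_rewrite[where c = "- 3", simplified, OF xy])
qed

section \<open>The algebra U\<close>

instantiation ugen :: presented
begin

definition relators_ugen :: "upoly set" where "relators_ugen = U_rels"

instance
  by standard (auto simp: relators_ugen_def U_rels_def)

end

lemma cls_U_rel: "r \<in> U_rels \<Longrightarrow> cls r = 0"
  by (simp add: cls_relator relators_ugen_def)

abbreviation uE :: "int \<Rightarrow> ugen palg" where "uE i \<equiv> cls (gE i)"
abbreviation uF :: "int \<Rightarrow> ugen palg" where "uF i \<equiv> cls (gF i)"
abbreviation uK :: "weight \<Rightarrow> ugen palg" where "uK l \<equiv> cls (gK l)"

lemma uK_mult: "uK l * uK m = uK (\<lambda>j. l j + m j)"
proof -
  have "nc_diff (nc_mult (gK l) (gK m)) (gK (\<lambda>j. l j + m j)) \<in> U_rels"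
    unfolding U_rels_def by blast
  from cls_U_rel[OF this] show ?thesis by (simp add: cls_simps)
qed

lemma uK_zero: "uK (\<lambda>j. 0) = 1"
proof -
  have "nc_diff (gK (\<lambda>j. 0)) nc_one \<in> U_rels"
    unfolding U_rels_def by blast
  from cls_U_rel[OF this] show ?thesis by (simp add: cls_simps)
qed

lemma uK_uF: "uK l * uF i = scl (qpow (- pair_coroot l i)) (uF i * uK l)"
proof -
  have "nc_diff (nc_mult (gK l) (gF i)) (nc_smult (qpow (- pair_coroot l i)) (nc_mult (gF i) (gK l)))
      \<in> U_rels"
    unfolding U_rels_def by blast
  from cls_U_rel[OF this] show ?thesis by (simp add: cls_simps)
qed

lemma uK_uE: "uK l * uE i = scl (qpow (pair_coroot l i)) (uE i * uK l)"
proof -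
  have "nc_diff (nc_mult (gK l) (gE i)) (nc_smult (qpow (pair_coroot l i)) (nc_mult (gE i) (gK l)))
      \<in> U_rels"
    unfolding U_rels_def by blast
  from cls_U_rel[OF this] show ?thesis by (simp add: cls_simps)
qed

lemma uE_uF: "uE i * uF j = scl (qpow (betaij i j)) (uF j * uE i)
  + (if i = j then scl (inverse (qq - inverse qq)) (uK (alpha i) - uK (\<lambda>k. - alpha i k)) else 0)"
proof -
  have "nc_diff (nc_diff (nc_mult (gE i) (gF j)) (nc_smult (qpow (betaij i j)) (nc_mult (gF j) (gE i))))
      (if i = j then nc_smult (inverse (qq - inverse qq)) (nc_diff (gK (alpha i)) (gK (\<lambda>k. - alpha i k)))
       else nc_zero) \<in> U_rels"
    unfolding U_rels_def by blast
  from cls_U_rel[OF this] show ?thesis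
    by (cases "i = j") (simp_all add: cls_simps algebra_simps)
qed

lemma uF_uF:
  assumes "\<bar>i - j\<bar> > 1"
  shows "uF i * uF j = scl (qpow (bij i j)) (uF j * uF i)"
proof -
  have "nc_diff (nc_mult (gF i) (gF j)) (nc_smult (qpow (bij i j)) (nc_mult (gF j) (gF i))) \<in> U_rels"
    unfolding U_rels_def using assms by blast
  from cls_U_rel[OF this] show ?thesis by (simp add: cls_simps)
qed

lemma uE_uE:
  assumes "\<bar>i - j\<bar> > 1"
  shows "uE i * uE j = scl (qpow (bij i j)) (uE j * uE i)"
proof -
  have "nc_diff (nc_mult (gE i) (gE j)) (nc_smult (qpow (bij i j)) (nc_mult (gE j) (gE i))) \<in> U_rels"
    unfolding U_rels_def using assms by blast
  from cls_U_rel[OF this] show ?thesis by (simp add: cls_simps)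
qed

lemma cls_serre:
  "nc_poly a \<Longrightarrow> nc_poly b \<Longrightarrow> cls (serre_expr c a b) =
    scl (qpow c) (cls a * cls a * cls b) - scl qtwo (cls a * cls b * cls a)
      + scl (qpow (- c)) (cls b * cls a * cls a)"
  by (simp add: serre_expr_def nc_mult3_def cls_simps)

lemma uF_serre_up:
  "scl (qpow 3) (uF i * uF i * uF (i + 1)) - scl qtwo (uF i * uF (i + 1) * uF i)
    + scl (qpow (- 3)) (uF (i + 1) * uF i * uF i) = 0"
proof -
  have "serre_expr 3 (gF i) (gF (i + 1)) \<in> U_rels"
    unfolding U_rels_def by blast
  from cls_U_rel[OF this] show ?thesis by (simp add: cls_serre)
qed

lemma uF_serre_down:
  "scl (qpow (- 3)) (uF i * uF i * uF (i - 1)) - scl qtwo (uF i * uF (i - 1) * uF i)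
    + scl (qpow 3) (uF (i - 1) * uF i * uF i) = 0"
proof -
  have "serre_expr (- 3) (gF i) (gF (i - 1)) \<in> U_rels"
    unfolding U_rels_def by blast
  from cls_U_rel[OF this] show ?thesis by (simp add: cls_serre)
qed

lemma uE_serre_up:
  "scl (qpow 3) (uE i * uE i * uE (i + 1)) - scl qtwo (uE i * uE (i + 1) * uE i)
    + scl (qpow (- 3)) (uE (i + 1) * uE i * uE i) = 0"
proof -
  have "serre_expr 3 (gE i) (gE (i + 1)) \<in> U_rels"
    unfolding U_rels_def by blast
  from cls_U_rel[OF this] show ?thesis by (simp add: cls_serre)
qed

lemma uE_serre_down:
  "scl (qpow (- 3)) (uE i * uE i * uE (i - 1)) - scl qtwo (uE i * uE (i - 1) * uE i)
    + scl (qpow 3) (uE (i - 1) * uE i * uE i) = 0"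
proof -
  have "serre_expr (- 3) (gE i) (gE (i - 1)) \<in> U_rels"
    unfolding U_rels_def by blast
  from cls_U_rel[OF this] show ?thesis by (simp add: cls_serre)
qed

section \<open>Cartan integers and the exponents of the relations\<close>

definition cartan :: "int \<Rightarrow> int \<Rightarrow> int" where
  "cartan i j = (if i = j then 2 else if \<bar>i - j\<bar> = 1 then - 1 else 0)"

lemma cartan_commute: "cartan i j = cartan j i"
  by (auto simp: cartan_def)

lemma pair_coroot_alpha: "pair_coroot (alpha i) j = cartan i j"
  by (auto simp: pair_coroot_def alpha_def cartan_def)

lemma pair_coroot_uminus: "pair_coroot (\<lambda>k. - l k) j = - pair_coroot l j"
  by (simp add: pair_coroot_def)

lemma pair_coroot_add: "pair_coroot (\<lambda>k. l k + m k) j = pair_coroot l j + pair_coroot m j"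
  by (simp add: pair_coroot_def)

lemma sgnpow_eq: "sgnpow i = (if even i then 1 else - 1)"
proof -
  have "even (nat \<bar>i\<bar>) \<longleftrightarrow> even i"
    by (simp add: even_nat_iff)
  then show ?thesis by (simp add: sgnpow_def)
qed

lemma betaij_same: "betaij i i = 0"
  by (simp add: betaij_def pair_coroot_def gamma_def alpha_def beta_def sgnpow_eq)

lemma betaij_up: "betaij i (i + 1) = 3"
  by (simp add: betaij_def pair_coroot_def gamma_def alpha_def beta_def sgnpow_eq)

lemma betaij_down: "betaij i (i - 1) = - 3"
  by (simp add: betaij_def pair_coroot_def gamma_def alpha_def beta_def sgnpow_eq)

lemma betaij_far: "\<bar>i - j\<bar> > 1 \<Longrightarrow> betaij i j = - bij i j"
  by (auto simp: betaij_def pair_coroot_def gamma_def alpha_def beta_def sgnpow_eq bij_def sgn_if)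

lemma bij_far: "\<bar>i - j\<bar> > 1 \<Longrightarrow> bij i j = (if i < j then 4 else - 4) * (if even (j - i) then 1 else - 1)"
  by (auto simp: bij_def sgnpow_eq sgn_if)

text \<open>Moving k and m to the right costs the same power of q in all three monomials, namely
  q^0: the contributions are -2 + 1 + 1 each time. The Serre relation of a, b thus survives
  multiplication by k k m.\<close>

lemma twisted_serre:
  fixes a b k m :: "'g::presented palg"
  assumes ab: "scl (qpow c) (a * a * b) - scl qtwo (a * b * a) + scl (qpow (- c)) (b * a * a) = 0"
    and ka: "k * a = scl (qpow (- 2)) (a * k)" and kb: "k * b = scl (qpow 1) (b * k)"
    and ma: "m * a = scl (qpow 1) (a * m)" and mb: "m * b = scl (qpow (- 2)) (b * m)"
    and mk: "m * k = k * m"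
  shows "scl (qpow c) (a * k * (a * k) * (b * m)) - scl qtwo (a * k * (b * m) * (a * k))
    + scl (qpow (- c)) (b * m * (a * k) * (a * k)) = 0"
proof -
  note swaps = ka kb ma mb mk
  have "scl (qpow c) (a * k * (a * k) * (b * m)) - scl qtwo (a * k * (b * m) * (a * k))
      + scl (qpow (- c)) (b * m * (a * k) * (a * k))
    = (scl (qpow c) (a * a * b) - scl qtwo (a * b * a) + scl (qpow (- c)) (b * a * a)) * (k * k * m)"
    by (simp add: palg_linear scl_add_left qtwo_eq swaps swaps[THEN swap_rewrite])
  then show ?thesis using ab by simp
qed

section \<open>The elements E_i K_(-alpha_i)\<close>

definition uX :: "int \<Rightarrow> ugen palg" where
  "uX i = uE i * uK (\<lambda>k. - alpha i k)"

definition uL :: "int \<Rightarrow> ugen palg" where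
  "uL i = uK (\<lambda>k. - alpha i k + - alpha i k)"

lemma uK_commute: "uK l * uK m = uK m * uK l"
  by (simp add: uK_mult add.commute)

lemma uK_uX: "uK l * uX i = scl (qpow (pair_coroot l i)) (uX i * uK l)"
  by (simp add: uX_def palg_linear uK_uE uK_uE[THEN swap_rewrite] uK_commute[of l])

text \<open>The factor q^2 comes from moving K_(-alpha_i) past F_i. The difference of K-terms times
  K_(-alpha_i) is 1 - K_(-2 alpha_i).\<close>

lemma uX_uF: "uX i * uF j = scl (qpow (cartan i j + betaij i j)) (uF j * uX i)
  + (if i = j then scl (qpow 2 * inverse (qq - inverse qq)) (1 - uL i) else 0)"
proof -
  have "uX i * uF j = scl (qpow (cartan i j)) (uE i * uF j * uK (\<lambda>k. - alpha i k))"
    by (simp add: uX_def palg_linear uK_uF pair_coroot_uminus pair_coroot_alpha)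
  also have "\<dots> = scl (qpow (cartan i j + betaij i j)) (uF j * uX i)
     + (if i = j then scl (qpow 2 * inverse (qq - inverse qq)) (1 - uL i) else 0)"
    by (simp add: uE_uF uX_def palg_linear)
      (simp add: cartan_def scl_scl uK_mult uK_zero uL_def)
  finally show ?thesis .
qed

lemma uX_uX: "uX i * uX j = scl (qpow (- cartan i j))
  (uE i * uE j * uK (\<lambda>k. - alpha i k + - alpha j k))"
proof -
  have "uX i * uX j = uE i * (uK (\<lambda>k. - alpha i k) * uE j) * uK (\<lambda>k. - alpha j k)"
    by (simp add: uX_def mult.assoc)
  also have "\<dots> = scl (qpow (- cartan i j))
      (uE i * uE j * (uK (\<lambda>k. - alpha i k) * uK (\<lambda>k. - alpha j k)))"
    by (simp only: uK_uE pair_coroot_uminus pair_coroot_alpha scl_mult_left scl_mult_right mult.assoc)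
  finally show ?thesis by (simp only: uK_mult)
qed

text \<open>By \<open>uX_uX\<close> the prefactor and the K-weight are symmetric in i and j, so the
  exchange affects only E_i E_j.\<close>

lemma uX_uX_far:
  assumes "\<bar>i - j\<bar> > 1"
  shows "uX i * uX j = scl (qpow (bij i j)) (uX j * uX i)"
  by (simp only: uX_uX uE_uE[OF assms] scl_mult_left scl_qpow_scl_qpow cartan_commute[of j i] add.commute)

lemma uX_serre_up:
  "scl (qpow 3) (uX i * uX i * uX (i + 1)) - scl qtwo (uX i * uX (i + 1) * uX i)
    + scl (qpow (- 3)) (uX (i + 1) * uX i * uX i) = 0"
  unfolding uX_def
  by (rule twisted_serre, rule uE_serre_up)
    (simp_all add: uK_uE pair_coroot_uminus pair_coroot_alpha cartan_def uK_commute)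

lemma uX_serre_down:
  "scl (qpow (- 3)) (uX i * uX i * uX (i - 1)) - scl qtwo (uX i * uX (i - 1) * uX i)
    + scl (qpow 3) (uX (i - 1) * uX i * uX i) = 0"
  unfolding uX_def
  by (rule twisted_serre[where c = "- 3", simplified], rule uE_serre_down)
    (simp_all add: uK_uE pair_coroot_uminus pair_coroot_alpha cartan_def uK_commute)

section \<open>The electrical relations in U\<close>

definition uJ :: "int \<Rightarrow> int \<Rightarrow> ugen palg" where
  "uJ eps i = uF i + scl (qpow (eps - 1)) (uX (i - 1))"

lemma nc_poly_jgen [simp]: "nc_poly (jgen eps i)"
  by (simp add: jgen_def)

lemma cls_jgen: "cls (jgen eps i) = uJ eps i"
  by (simp add: jgen_def uJ_def uX_def cls_simps)

lemma uJ_far: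
  assumes "\<bar>i - j\<bar> > 1"
  shows "uJ eps i * uJ eps j = scl (qpow (bij i j)) (uJ eps j * uJ eps i)"
proof -
  have comm: "uX (i - 1) * uF j = scl (qpow (bij i j)) (uF j * uX (i - 1))"
    if "\<bar>i - j\<bar> > 1" for i j
  proof -
    \<comment> \<open>Among the admissible j only i - 2 is a neighbour of i - 1. There
      \<open>betaij\<close> contributes -3 and K contributes -1, which add up to b_ij = -4;
      elsewhere K contributes nothing and \<open>betaij\<close> alone gives b_ij.\<close>
    consider "j = i - 2" | "i - 1 \<noteq> j" "\<bar>i - 1 - j\<bar> > 1" using \<open>\<bar>i - j\<bar> > 1\<close> by linarith
    then show ?thesis
    proof cases
      case 1
      then have "betaij (i - 1) j = - 3" "cartan (i - 1) j = - 1" "bij i j = - 4" "i - 1 \<noteq> j"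
        using betaij_down[of "i - 1"] bij_far[of i j] by (simp_all add: cartan_def)
      then show ?thesis by (simp add: uX_uF)
    next
      case 2
      then have "betaij (i - 1) j = bij i j"
        using that betaij_far[of "i - 1" j] bij_far[of i j] bij_far[of "i - 1" j] by auto
      with 2 show ?thesis by (simp add: uX_uF cartan_def)
    qed
  qed
  have comm': "uF i * uX (j - 1) = scl (qpow (bij i j)) (uX (j - 1) * uF i)"
  proof -
    have "bij i j + bij j i = 0"
      using assms bij_far[of i j] bij_far[of j i] by auto
    then show ?thesis
      using comm[of j i] assms by (simp add: scl_qpow_scl_qpow scl_qpow_zero)
  qed
  have "bij (i - 1) (j - 1) = bij i j"
    by (simp add: bij_def)
  then have "uX (i - 1) * uX (j - 1) = scl (qpow (bij i j)) (uX (j - 1) * uX (i - 1))"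
    using uX_uX_far[of "i - 1" "j - 1"] assms by simp
  then show ?thesis
    using comm[OF assms] comm' uF_uF[OF assms]
    by (simp add: uJ_def scl_mult_left scl_mult_right scl_scl scl_add_right distrib_left distrib_right mult_ac)
qed

lemma qq_minus_inverse: "qq - inverse qq = qpow 1 - qpow (- 1)"
  by (simp add: qpow_def power_int_minus)

text \<open>Here the normalization q^(eps-1) in j is accounted for: q^(-3) - q = - q^(-1) [2] (q -
  q^(-1)), the last factor cancels the denominator, and the exponents (eps - 1) + 2 - 1 add up to
  eps.\<close>

lemma electrical_scalar:
  fixes e :: int and z :: "'g::presented palg"
  defines "t \<equiv> qpow (e - 1) * (qpow 2 * inverse (qq - inverse qq))"
  shows "scl t (scl (qpow (- 3)) z - scl (qpow 1) z) = - scl (qpow e * qtwo) z"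
proof -
  have "qpow (- 3) - qpow 1 = - (qpow (- 1) * qtwo * (qpow 1 - qpow (- 1)))"
    by (simp add: qtwo_eq algebra_simps qpow_add[symmetric])
  then have "t * (qpow (- 3) - qpow 1) = - (qpow (e - 1) * qpow 2 * qpow (- 1) * qtwo)
      * (inverse (qpow 1 - qpow (- 1)) * (qpow 1 - qpow (- 1)))"
    by (simp add: t_def qq_minus_inverse mult_ac)
  also have "\<dots> = - (qpow (e - 1) * qpow 2 * qpow (- 1) * qtwo)"
    using qpow_diff_nonzero by simp
  also have "\<dots> = - (qpow e * qtwo)"
    by (simp add: qpow_add[symmetric])
  finally have "scl (t * (qpow (- 3) - qpow 1)) z = - scl (qpow e * qtwo) z"
    by (simp add: scl_minus_left)
  moreover have "scl (qpow (- 3)) z - scl (qpow 1) z = scl (qpow (- 3) - qpow 1) z"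
    using scl_add_left[of "qpow (- 3) - qpow 1" "qpow 1" z] by (simp add: algebra_simps)
  ultimately show ?thesis by (simp add: scl_scl)
qed

text \<open>The Serre expression is homogeneous of degree three, so d^3 factors out.\<close>

lemma scaled_serre:
  assumes "scl (qpow c) (x * x * y) - scl qtwo (x * y * x) + scl (qpow (- c)) (y * x * x) = 0"
  shows "scl (qpow c) (scl d x * scl d x * scl d y) - scl qtwo (scl d x * scl d y * scl d x)
    + scl (qpow (- c)) (scl d y * scl d x * scl d x) = 0"
proof -
  have "scl (qpow c) (scl d x * scl d x * scl d y) - scl qtwo (scl d x * scl d y * scl d x)
    + scl (qpow (- c)) (scl d y * scl d x * scl d x)
    = scl (d * d * d) (scl (qpow c) (x * x * y) - scl qtwo (x * y * x) + scl (qpow (- c)) (y * x * x))"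
    by (simp add: scl_mult_left scl_mult_right scl_add_right scl_diff_right scl_scl mult_ac)
  then show ?thesis using assms by (simp add: scl_zero_right)
qed

lemma uL_uF: "uL i * uF j = scl (qpow (2 * cartan i j)) (uF j * uL i)"
  by (simp add: uL_def uK_uF pair_coroot_add[of "\<lambda>k. - alpha i k" "\<lambda>k. - alpha i k", simplified]
     pair_coroot_uminus pair_coroot_alpha)

lemma uL_uX: "uL i * uX j = scl (qpow (- 2 * cartan i j)) (uX j * uL i)"
  by (simp add: uL_def uK_uX pair_coroot_add[of "\<lambda>k. - alpha i k" "\<lambda>k. - alpha i k", simplified]
     pair_coroot_uminus pair_coroot_alpha)

lemma scaled_uX_uF: "scl d (uX i) * uF j = scl (qpow (cartan i j + betaij i j)) (uF j * scl d (uX i))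
  + (if i = j then scl (d * (qpow 2 * inverse (qq - inverse qq))) (1 - uL i) else 0)"
  by (cases "i = j")
    (simp_all add: scl_mult_left scl_mult_right uX_uF scl_add_right scl_scl mult.commute)

lemma uL_scaled_uX: "uL i * scl d (uX j) = scl (qpow (- 2 * cartan i j)) (scl d (uX j) * uL i)"
  by (simp add: scl_mult_left scl_mult_right uL_uX scl_scl mult.commute)

lemma uJ_serre_up:
  "scl (qpow 3) (uJ eps i * uJ eps i * uJ eps (i + 1)) - scl qtwo (uJ eps i * uJ eps (i + 1) * uJ eps i)
    + scl (qpow (- 3)) (uJ eps (i + 1) * uJ eps i * uJ eps i) = - scl (qpow eps * qtwo) (uJ eps i)"
proof -
  let ?d = "qpow (eps - 1)"
  let ?x = "scl ?d (uX (i - 1))" and ?y = "scl ?d (uX i)"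
  have "betaij (i - 1) (i + 1) = - 4"
    using betaij_far[of "i - 1" "i + 1"] bij_far[of "i - 1" "i + 1"] by simp
  moreover have "betaij (i - 1) i = 3" using betaij_up[of "i - 1"] by simp
  ultimately have
    "?x * uF i = scl (qpow 2) (uF i * ?x)"
    "?x * uF (i + 1) = scl (qpow (- 4)) (uF (i + 1) * ?x)"
    "?y * uF (i + 1) = scl (qpow 2) (uF (i + 1) * ?y)"
    "?y * uF i = scl (qpow 2) (uF i * ?y)
      + scl (?d * (qpow 2 * inverse (qq - inverse qq))) (1 - uL i)"
    "uL i * uF i = scl (qpow 4) (uF i * uL i)"
    "uL i * ?x = scl (qpow 2) (?x * uL i)"
    by (simp_all add: scaled_uX_uF uL_uF uL_scaled_uX cartan_def betaij_same betaij_up)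
  moreover have "scl (qpow 3) (?x * ?x * ?y) - scl qtwo (?x * ?y * ?x)
      + scl (qpow (- 3)) (?y * ?x * ?x) = 0"
    using scaled_serre[OF uX_serre_up[of "i - 1"]] by (simp only: diff_add_cancel)
  ultimately show ?thesis
    using electrical_serre_up[OF uF_serre_up, of ?x ?y i "?d * (qpow 2 * inverse (qq - inverse qq))" "uL i"]
    by (simp only: uJ_def electrical_scalar add_diff_cancel_right')
qed

lemma uJ_serre_down:
  "scl (qpow (- 3)) (uJ eps i * uJ eps i * uJ eps (i - 1)) - scl qtwo (uJ eps i * uJ eps (i - 1) * uJ eps i)
    + scl (qpow 3) (uJ eps (i - 1) * uJ eps i * uJ eps i) = - scl (qpow eps * qtwo) (uJ eps i)"
proof -
  let ?d = "qpow (eps - 1)"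
  let ?x = "scl ?d (uX (i - 1))" and ?y = "scl ?d (uX (i - 1 - 1))"
  have "betaij (i - 1 - 1) i = - 4"
    using betaij_far[of "i - 2" "i"] bij_far[of "i - 2" "i"] by simp
  moreover have "betaij (i - 1) i = 3" using betaij_up[of "i - 1"] by simp
  moreover have "betaij (i - 1 - 1) (i - 1) = 3" using betaij_up[of "i - 2"] by simp
  ultimately have
    "?x * uF i = scl (qpow 2) (uF i * ?x)"
    "?x * uF (i - 1) = scl (qpow 2) (uF (i - 1) * ?x)
      + scl (?d * (qpow 2 * inverse (qq - inverse qq))) (1 - uL (i - 1))"
    "?y * uF (i - 1) = scl (qpow 2) (uF (i - 1) * ?y)"
    "?y * uF i = scl (qpow (- 4)) (uF i * ?y)"
    "uL (i - 1) * uF i = scl (qpow (- 2)) (uF i * uL (i - 1))"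
    "uL (i - 1) * ?x = scl (qpow (- 4)) (?x * uL (i - 1))"
    by (simp_all add: scaled_uX_uF uL_uF uL_scaled_uX cartan_def betaij_same)
  moreover have "scl (qpow (- 3)) (?x * ?x * ?y) - scl qtwo (?x * ?y * ?x)
      + scl (qpow 3) (?y * ?x * ?x) = 0"
    using scaled_serre[where c = "- 3", simplified, OF uX_serre_down[of "i - 1"]]
    by (simp only: diff_add_cancel)
  ultimately show ?thesis
    using electrical_serre_down[OF uF_serre_down, of ?x ?y i
        "?d * (qpow 2 * inverse (qq - inverse qq))" "uL (i - 1)"]
    by (simp only: uJ_def electrical_scalar)
qed

lemma El_rels_poly: "r \<in> El_rels eps \<Longrightarrow> nc_poly r"
  by (auto simp: El_rels_def)

lemma ev_uJ_El_rels:
  assumes "r \<in> El_rels eps"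
  shows "ev (uJ eps) r = 0"
proof -
  consider i j where "\<bar>i - j\<bar> > 1" "r = nc_diff (nc_mult (nc_gen i) (nc_gen j))
      (nc_smult (qpow (bij i j)) (nc_mult (nc_gen j) (nc_gen i)))"
    | i where "r = nc_add (serre_expr 3 (nc_gen i) (nc_gen (i + 1))) (nc_smult (qpow eps * qtwo) (nc_gen i))"
    | i where "r = nc_add (serre_expr (-3) (nc_gen i) (nc_gen (i - 1))) (nc_smult (qpow eps * qtwo) (nc_gen i))"
    using assms unfolding El_rels_def by blast
  then show ?thesis
  proof cases
    case (1 i j)
    then show ?thesis by (simp add: ev_simps uJ_far[of i j])
  next
    case (2 i)
    then show ?thesis using uJ_serre_up[of eps i] by (simp add: ev_simps ev_serre)
  next
    case (3 i)
    then show ?thesis using uJ_serre_down[of eps i] by (simp add: ev_simps ev_serre)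
  qed
qed

lemma cls_nc_eval:
  assumes "nc_poly p" "\<And>x. nc_poly (f x)"
  shows "cls (nc_eval f p) = ev (\<lambda>x. cls (f x)) p"
proof -
  have "cls (nc_eval f p) = ev (\<lambda>x. cls (nc_gen x)) (nc_eval f p)"
    using assms by (intro cls_eq_ev nc_poly_eval)
  also have "\<dots> = ev (\<lambda>x. cls (f x)) p"
    using assms by (simp add: ev_nc_eval cls_eq_ev[symmetric, OF assms(2)])
  finally show ?thesis .
qed

lemma nc_eval_jgen_ideal:
  assumes "p \<in> nc_ideal (El_rels eps)"
  shows "nc_eval (jgen eps) p \<in> nc_ideal U_rels"
proof -
  have p: "nc_poly p" using assms El_rels_poly nc_ideal_poly by blast
  have "cls (nc_eval (jgen eps) p) = ev (uJ eps) p"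
    using p by (simp add: cls_nc_eval cls_jgen)
  also have "\<dots> = 0"
    using assms El_rels_poly ev_uJ_El_rels by (rule ev_nc_ideal)
  finally show ?thesis
    using p by (simp add: cls_eq_zero_iff relators_ugen_def)
qed

section \<open>The coideal property\<close>

text \<open>On a sum of generator types the relators are those of a tensor product, which makes U
  \<otimes> U a quotient ring of the same kind as U.\<close>

instantiation sum :: (presented, presented) presented
begin

definition relators_sum :: "(('a + 'b) list \<Rightarrow> qrat) set" where
  "relators_sum = nc_eval (\<lambda>g. nc_gen (Inl g)) ` relators \<union> nc_eval (\<lambda>g. nc_gen (Inr g)) ` relators
     \<union> {nc_diff (nc_mult (nc_gen (Inl a)) (nc_gen (Inr b))) (nc_mult (nc_gen (Inr b)) (nc_gen (Inl a)))
         | a b. True}"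

instance
  by standard (auto simp: relators_sum_def nc_poly_relators)

end

lemma UU_rels_eq: "UU_rels = relators"
  by (simp add: UU_rels_def relators_sum_def relators_ugen_def tL_def tR_def)

definition gL :: "'a::presented \<Rightarrow> ('a + 'b::presented) palg" where
  "gL g = cls (nc_gen (Inl g))"

definition gR :: "'b::presented \<Rightarrow> ('a::presented + 'b) palg" where
  "gR g = cls (nc_gen (Inr g))"

lemma gR_gL: "gR b * gL a = gL a * gR b"
proof -
  have "nc_diff (nc_mult (nc_gen (Inl a)) (nc_gen (Inr b))) (nc_mult (nc_gen (Inr b)) (nc_gen (Inl a)))
      \<in> relators"
    unfolding relators_sum_def by blast
  from cls_relator[OF this] show ?thesis by (simp add: cls_simps gL_def gR_def)
qed

lemma ev_gL_relator:
  fixes r :: "'a::presented list \<Rightarrow> qrat"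
  assumes "r \<in> relators"
  shows "ev gL r = (0 :: ('a + 'b::presented) palg)"
proof -
  let ?t = "nc_eval (\<lambda>g. nc_gen (Inl g)) r :: ('a + 'b) list \<Rightarrow> qrat"
  have "?t \<in> relators"
    using assms unfolding relators_sum_def by blast
  then have "cls ?t = 0" by (rule cls_relator)
  then show ?thesis
    using nc_poly_relators[OF assms] by (simp add: cls_nc_eval gL_def[abs_def])
qed

lemma ev_gR_relator:
  fixes r :: "'b::presented list \<Rightarrow> qrat"
  assumes "r \<in> relators"
  shows "ev gR r = (0 :: ('a::presented + 'b) palg)"
proof -
  let ?t = "nc_eval (\<lambda>g. nc_gen (Inr g)) r :: ('a + 'b) list \<Rightarrow> qrat"
  have "?t \<in> relators"
    using assms unfolding relators_sum_def by blast
  then have "cls ?t = 0" by (rule cls_relator)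
  then show ?thesis
    using nc_poly_relators[OF assms] by (simp add: cls_nc_eval gR_def[abs_def])
qed

lemma ev_commute:
  assumes "nc_poly p" "nc_poly q" and comm: "\<And>x y. g x * h y = h y * g x"
  shows "ev g p * ev h q = ev h q * ev g p"
proof -
  have gen_word: "g x * prod_list (map h w) = prod_list (map h w) * g x" for x w
    by (induction w) (simp_all add: mult.assoc[symmetric] comm, simp add: mult.assoc)
  have gen: "g x * ev h q = ev h q * g x" for x
    using assms(2)
    by (induction q rule: nc_poly_induct)
      (simp_all add: gen_word ev_simps ev_word distrib_left distrib_right scl_mult_left scl_mult_right)
  have word: "prod_list (map g w) * ev h q = ev h q * prod_list (map g w)" for w
    by (induction w) (simp_all add: mult.assoc, simp add: mult.assoc[symmetric] gen)
  show ?thesis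
    using assms(1)
    by (induction p rule: nc_poly_induct)
      (simp_all add: word ev_simps ev_word distrib_left distrib_right scl_mult_left scl_mult_right)
qed

lemma nc_poly_tL [simp]: "nc_poly p \<Longrightarrow> nc_poly (tL p)"
  by (simp add: tL_def)

lemma nc_poly_tR [simp]: "nc_poly p \<Longrightarrow> nc_poly (tR p)"
  by (simp add: tR_def)

lemma cls_tL: "nc_poly p \<Longrightarrow> cls (tL p) = ev gL p"
  by (simp add: tL_def cls_nc_eval gL_def[abs_def])

lemma cls_tR: "nc_poly p \<Longrightarrow> cls (tR p) = ev gR p"
  by (simp add: tR_def cls_nc_eval gR_def[abs_def])

lemma nc_poly_Delta_gen [simp]: "nc_poly (Delta_gen g)"
  by (cases g) simp_all

lemma nc_poly_Delta [simp]: "nc_poly p \<Longrightarrow> nc_poly (Delta p)"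
  by (simp add: Delta_def)

lemma cls_Delta: "nc_poly p \<Longrightarrow> cls (Delta p) = ev (\<lambda>g. cls (Delta_gen g)) p"
  by (simp add: Delta_def cls_nc_eval)

lemma gL_UK_mult: "gL (UK l) * gL (UK m) = (gL (UK (\<lambda>j. l j + m j)) :: (ugen + ugen) palg)"
proof -
  have "nc_diff (nc_mult (gK l) (gK m)) (gK (\<lambda>j. l j + m j)) \<in> relators"
    unfolding relators_ugen_def U_rels_def by blast
  from ev_gL_relator[OF this] show ?thesis by (simp add: ev_simps)
qed

lemma gR_UK_mult: "gR (UK l) * gR (UK m) = (gR (UK (\<lambda>j. l j + m j)) :: (ugen + ugen) palg)"
proof -
  have "nc_diff (nc_mult (gK l) (gK m)) (gK (\<lambda>j. l j + m j)) \<in> relators"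
    unfolding relators_ugen_def U_rels_def by blast
  from ev_gR_relator[OF this] show ?thesis by (simp add: ev_simps)
qed

lemma gL_UK_zero: "gL (UK (\<lambda>j. 0)) = (1 :: (ugen + ugen) palg)"
proof -
  have "nc_diff (gK (\<lambda>j. 0)) nc_one \<in> relators"
    unfolding relators_ugen_def U_rels_def by blast
  from ev_gL_relator[OF this] show ?thesis by (simp add: ev_simps)
qed

text \<open>Multiplying the comultiplication of E_(i-1) by that of K_(-alpha_(i-1)) turns its first
  summand into 1 \<otimes> E K and leaves K_(-gamma_(i-1)) on the right of the second. Since
  -gamma_(i-1) = beta_i, this is the weight accompanying F_i, which explains the index shift in
  j.\<close>

lemma cls_Delta_jgen:
  "cls (Delta (jgen eps i))
    = ev gR (jgen eps i) + ev gL (jgen eps i) * (gR (UK (beta i)) :: (ugen + ugen) palg)"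
proof -
  let ?a = "alpha (i - 1)" and ?c = "qpow (eps - 1)"
  have beta: "(\<lambda>k. ?a k - gamma (i - 1) k + - ?a k) = beta i"
    by (simp add: gamma_def)
  have "cls (Delta_gen (UE (i - 1))) * cls (Delta_gen (UK (\<lambda>k. - ?a k)))
    = gL (UK ?a) * (gR (UE (i - 1)) * gL (UK (\<lambda>k. - ?a k))) * gR (UK (\<lambda>k. - ?a k))
      + gL (UE (i - 1)) * (gR (UK (\<lambda>k. ?a k - gamma (i - 1) k)) * gL (UK (\<lambda>k. - ?a k))) * gR (UK (\<lambda>k. - ?a k))"
    by (simp add: cls_simps gL_def[symmetric] gR_def[symmetric] distrib_right mult.assoc)
  also have "\<dots> = (gL (UK ?a) * gL (UK (\<lambda>k. - ?a k))) * (gR (UE (i - 1)) * gR (UK (\<lambda>k. - ?a k)))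
      + gL (UE (i - 1)) * gL (UK (\<lambda>k. - ?a k)) * (gR (UK (\<lambda>k. ?a k - gamma (i - 1) k)) * gR (UK (\<lambda>k. - ?a k)))"
    by (simp only: gR_gL mult.assoc)
  also have "\<dots> = gR (UE (i - 1)) * gR (UK (\<lambda>k. - ?a k))
      + gL (UE (i - 1)) * gL (UK (\<lambda>k. - ?a k)) * gR (UK (beta i))"
    by (simp only: gL_UK_mult gR_UK_mult beta) (simp add: gL_UK_zero)
  finally show ?thesis
    by (simp add: cls_Delta jgen_def ev_simps del: Delta_gen.simps)
      (simp add: cls_simps gL_def[symmetric] gR_def[symmetric] scl_add_right scl_mult_left
        distrib_right)
qed

section \<open>The subspace C \<otimes> U\<close>

lemma nc_poly_CU: "t \<in> CU eps \<Longrightarrow> nc_poly t"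
  by (induction rule: CU.induct) simp_all

lemma cls_CU_elem:
  assumes "nc_poly a" "nc_poly u"
  shows "cls (nc_mult (tL (nc_eval (jgen eps) a)) (tR u)) = ev (\<lambda>i. ev gL (jgen eps i)) a * ev gR u"
  using assms by (simp add: cls_mult cls_tL cls_tR ev_nc_eval)

text \<open>\<open>CU\<close> is generated by products and sums only, so the scalar is absorbed into
  the C-factor of each product; equality then holds between classes.\<close>

lemma CU_smult: "t \<in> CU eps \<Longrightarrow> \<exists>t'\<in>CU eps. cls t' = scl c (cls t)"
proof (induction rule: CU.induct)
  case zero
  show ?case by (rule bexI[OF _ CU.zero]) (simp add: cls_zero scl_zero_right)
next
  case (elem a u)
  then have "nc_mult (tL (nc_eval (jgen eps) (nc_smult c a))) (tR u) \<in> CU eps"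
    by (intro CU.elem nc_poly_smult)
  moreover have "cls (nc_mult (tL (nc_eval (jgen eps) (nc_smult c a))) (tR u))
      = scl c (cls (nc_mult (tL (nc_eval (jgen eps) a)) (tR u)))"
    using elem by (simp add: cls_CU_elem ev_smult scl_mult_left)
  ultimately show ?case by blast
next
  case (add x y)
  then obtain x' y' where "x' \<in> CU eps" "cls x' = scl c (cls x)" "y' \<in> CU eps" "cls y' = scl c (cls y)"
    by blast
  then show ?case
    using add.hyps by (intro bexI[of _ "nc_add x' y'"] CU.add) (simp_all add: nc_poly_CU cls_add scl_add_right)
qed

text \<open>Multiplication by \<open>1 \<otimes> j(i)\<close> changes only the U-factor; multiplication by
\<open>j(i) \<otimes> K\<close> changes both.\<close>

lemma CU_mult_Delta_jgen: "t \<in> CU eps \<Longrightarrow> \<exists>t'\<in>CU eps. cls t' = cls (Delta (jgen eps i)) * cls t"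
proof (induction rule: CU.induct)
  case zero
  show ?case by (rule bexI[OF _ CU.zero]) (simp add: cls_zero)
next
  case (elem a u)
  let ?l = "\<lambda>i. ev gL (jgen eps i) :: (ugen + ugen) palg"
  let ?s = "nc_mult (tL (nc_eval (jgen eps) a)) (tR (nc_mult (jgen eps i) u))"
  let ?t = "nc_mult (tL (nc_eval (jgen eps) (nc_mult (nc_gen i) a))) (tR (nc_mult (gK (beta i)) u))"
  have "?s \<in> CU eps" "?t \<in> CU eps"
    using elem by (auto intro!: CU.elem)
  then have "nc_add ?s ?t \<in> CU eps" "nc_poly ?s" "nc_poly ?t"
    by (simp_all add: CU.add nc_poly_CU)
  moreover have "cls ?s + cls ?t = cls (Delta (jgen eps i)) * cls (nc_mult (tL (nc_eval (jgen eps) a)) (tR u))"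
  proof -
    have comm: "ev gR v * ev ?l a = ev ?l a * ev gR v" if "nc_poly v" for v
      using that elem ev_commute[OF that, of "nc_eval (jgen eps) a" gR gL]
      by (simp add: ev_nc_eval gR_gL)
    have "cls ?s = ev ?l a * ev gR (jgen eps i) * ev gR u"
      using elem by (simp add: cls_CU_elem ev_mult mult.assoc)
    moreover have "cls ?t = ?l i * (ev ?l a * ev gR (gK (beta i))) * ev gR u"
      using elem by (simp add: cls_CU_elem ev_mult ev_gen mult.assoc)
    ultimately show ?thesis
      using elem comm[of "jgen eps i"] comm[of "gK (beta i)"]
      by (simp add: cls_CU_elem cls_Delta_jgen distrib_right mult.assoc[symmetric] ev_gen)
        (simp add: mult.assoc)
  qed
  ultimately show ?case by (intro bexI[of _ "nc_add ?s ?t"]) (simp_all add: cls_add)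
next
  case (add x y)
  then obtain x' y' where "x' \<in> CU eps" "cls x' = cls (Delta (jgen eps i)) * cls x"
    "y' \<in> CU eps" "cls y' = cls (Delta (jgen eps i)) * cls y"
    by blast
  then show ?case
    using add.hyps by (intro bexI[of _ "nc_add x' y'"] CU.add) (simp_all add: nc_poly_CU cls_add distrib_left)
qed

lemma CU_one: "\<exists>t\<in>CU eps. cls t = 1"
  using CU.elem[of nc_one nc_one eps] cls_CU_elem[of nc_one nc_one eps]
  by (intro bexI) (auto simp: ev_one)

text \<open>The comultiplication of j of a word is a product of those of its letters, so left
  multiplication by these, starting from 1 \<otimes> 1, reaches everything without closure of C
  \<otimes> U under general products.\<close>

lemma Delta_nc_eval_jgen_CU:
  assumes "nc_poly p"
  shows "\<exists>t\<in>CU eps. nc_diff (Delta (nc_eval (jgen eps) p)) t \<in> nc_ideal UU_rels"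
proof -
  let ?D = "\<lambda>i. cls (Delta (jgen eps i)) :: (ugen + ugen) palg"
  have word: "\<exists>t\<in>CU eps. cls t = prod_list (map ?D w)" for w
  proof (induction w)
    case (Cons i w)
    then show ?case using CU_mult_Delta_jgen[of _ eps i] by fastforce
  qed (simp add: CU_one)
  have "\<exists>t\<in>CU eps. cls t = ev ?D p"
    using assms
  proof (induction p rule: nc_poly_induct)
    case zero
    show ?case by (rule bexI[OF _ CU.zero]) (simp add: cls_zero ev_zero)
  next
    case (step c w p)
    from step.IH obtain t where t: "t \<in> CU eps" "cls t = ev ?D p" by blast
    from word obtain s where "s \<in> CU eps" "cls s = prod_list (map ?D w)" by blast
    then obtain s' where s': "s' \<in> CU eps" "cls s' = scl c (prod_list (map ?D w))"
      using CU_smult[of s eps c] by auto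
    from t s' show ?case
      using step.hyps
      by (intro bexI[of _ "nc_add s' t"] CU.add) (simp_all add: cls_add nc_poly_CU ev_simps ev_word)
  qed
  then obtain t where t: "t \<in> CU eps" "cls t = ev ?D p" by blast
  have "cls (Delta (nc_eval (jgen eps) p)) = ev ?D p"
    using assms by (simp add: cls_Delta ev_nc_eval)
  with t have "cls (nc_diff (Delta (nc_eval (jgen eps) p)) t) = 0"
    using assms by (simp add: cls_diff nc_poly_CU)
  then show ?thesis
    using t assms by (intro bexI[of _ t]) (simp_all add: cls_eq_zero_iff nc_poly_CU UU_rels_eq)
qed

lemma Delta_jgen:
  "nc_diff (Delta (jgen eps i))
    (nc_add (tR (jgen eps i)) (nc_mult (tL (jgen eps i)) (nc_gen (Inr (UK (beta i))))))
    \<in> nc_ideal UU_rels"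
proof -
  have "cls (nc_diff (Delta (jgen eps i))
    (nc_add (tR (jgen eps i)) (nc_mult (tL (jgen eps i)) (nc_gen (Inr (UK (beta i))))))) = 0"
    by (simp add: cls_diff cls_add cls_mult cls_tL cls_tR cls_Delta_jgen gR_def[symmetric])
  then show ?thesis by (simp add: cls_eq_zero_iff UU_rels_eq)
qed

section \<open>The Verma module of highest weight zero for U without the relations among the F\<close>

definition wt :: "weight \<Rightarrow> int list \<Rightarrow> int" where
  "wt l w = sum_list (map (pair_coroot l) w)"

abbreviation opF :: "int \<Rightarrow> elpoly \<Rightarrow> elpoly" where "opF j \<equiv> nc_mult (nc_gen j)"

text \<open>The empty word is fixed by K, and each letter moved past K contributes q to minus its
  pairing.\<close>

definition opK :: "weight \<Rightarrow> elpoly \<Rightarrow> elpoly" where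
  "opK l x = (\<lambda>w. qpow (- wt l w) * x w)"

text \<open>The commutator of \<open>E_k\<close> and \<open>F_k\<close>.\<close>

definition opH :: "int \<Rightarrow> elpoly \<Rightarrow> elpoly" where
  "opH k x = nc_smult (inverse (qq - inverse qq))
     (nc_diff (opK (alpha k) x) (opK (\<lambda>j. - alpha k j) x))"

text \<open>The coefficient of the word \<open>v\<close> in \<open>E_k x\<close>. Working with coefficients makes E total on all
functions, finitely supported or not; the recursion transcribes \<open>opE_opF\<close> below.\<close>

primrec opE_coeff :: "int \<Rightarrow> int list \<Rightarrow> elpoly \<Rightarrow> qrat" where
  "opE_coeff k [] x = 0"
| "opE_coeff k (j # v) x
    = qpow (betaij k j) * opE_coeff k v (\<lambda>w. x (j # w)) + opH k (\<lambda>w. x (k # w)) (j # v)"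

definition opE :: "int \<Rightarrow> elpoly \<Rightarrow> elpoly" where
  "opE k x = (\<lambda>v. opE_coeff k v x)"

lemma opK_linear:
  "opK l (nc_add x y) = nc_add (opK l x) (opK l y)"
  "opK l (nc_diff x y) = nc_diff (opK l x) (opK l y)"
  "opK l (nc_smult c x) = nc_smult c (opK l x)"
  "opK l nc_zero = nc_zero"
  by (simp_all add: opK_def nc_add_def nc_diff_def nc_smult_def nc_zero_def algebra_simps)

lemma opH_linear:
  "opH k (nc_add x y) = nc_add (opH k x) (opH k y)"
  "opH k (nc_diff x y) = nc_diff (opH k x) (opH k y)"
  "opH k (nc_smult c x) = nc_smult c (opH k x)"
  "opH k nc_zero = nc_zero"
  by (simp_all add: opH_def opK_linear, simp_all add: nc_add_def nc_diff_def nc_smult_def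
      nc_zero_def algebra_simps)

lemma opE_coeff_add: "opE_coeff k v (nc_add x y) = opE_coeff k v x + opE_coeff k v y"
proof (induction v arbitrary: x y)
  case (Cons j v)
  have "(\<lambda>w. nc_add x y (a # w)) = nc_add (\<lambda>w. x (a # w)) (\<lambda>w. y (a # w))" for a
    by (simp add: nc_add_def)
  then show ?case
    by (simp add: Cons opH_linear) (simp add: nc_add_def algebra_simps)
qed simp

lemma opE_coeff_smult: "opE_coeff k v (nc_smult c x) = c * opE_coeff k v x"
proof (induction v arbitrary: x)
  case (Cons j v)
  have "(\<lambda>w. nc_smult c x (a # w)) = nc_smult c (\<lambda>w. x (a # w))" for a
    by (simp add: nc_smult_def)
  then show ?case
    by (simp add: Cons opH_linear) (simp add: nc_smult_def algebra_simps)
qed simp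

lemma opE_linear:
  "opE k (nc_add x y) = nc_add (opE k x) (opE k y)"
  "opE k (nc_diff x y) = nc_diff (opE k x) (opE k y)"
  "opE k (nc_smult c x) = nc_smult c (opE k x)"
  "opE k nc_zero = nc_zero"
proof -
  show add: "opE k (nc_add x y) = nc_add (opE k x) (opE k y)" for x y
    by (simp add: opE_def opE_coeff_add) (simp add: nc_add_def)
  show smult: "opE k (nc_smult c x) = nc_smult c (opE k x)" for c x
    by (simp add: opE_def opE_coeff_smult) (simp add: nc_smult_def)
  show "opE k (nc_diff x y) = nc_diff (opE k x) (opE k y)"
    by (simp add: nc_diff_conv_add add smult)
  show "opE k nc_zero = nc_zero"
    using smult[of 0 nc_zero] by (simp add: nc_smult_def nc_zero_def)
qed

lemmas op_linear = opK_linear opE_linear nc_mult_linear nc_smult_add nc_smult_diff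

lemma wt_Nil: "wt l [] = 0"
  by (simp add: wt_def)

lemma wt_Cons: "wt l (j # w) = pair_coroot l j + wt l w"
  by (simp add: wt_def)

lemma wt_add: "wt (\<lambda>k. l k + m k) w = wt l w + wt m w"
  by (induction w) (simp_all add: wt_Nil wt_Cons pair_coroot_add)

lemma opK_opK: "opK l (opK m x) = opK (\<lambda>j. l j + m j) x"
  by (simp add: opK_def wt_add mult.assoc[symmetric] qpow_add[symmetric])

lemma opK_zero: "opK (\<lambda>j. 0) x = x"
proof -
  have "wt (\<lambda>j. 0) w = 0" for w
    by (induction w) (simp_all add: wt_Nil wt_Cons pair_coroot_def)
  then show ?thesis by (simp add: opK_def qpow_zero)
qed

lemma opK_opF: "opK l (opF j x) = nc_smult (qpow (- pair_coroot l j)) (opF j (opK l x))"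
proof
  show "opK l (opF j x) w = nc_smult (qpow (- pair_coroot l j)) (opF j (opK l x)) w" for w
    by (cases w) (simp_all add: opK_def nc_smult_def nc_gen_mult_Nil nc_gen_mult_Cons wt_Cons
        mult.assoc[symmetric] qpow_add[symmetric])
qed

text \<open>This is the relation between E and F on the module; together with
  \<open>opE_vacuum\<close> it replaces the recursion on coefficients from here on.\<close>

lemma opE_opF: "opE k (opF j x) = nc_add (nc_smult (qpow (betaij k j)) (opF j (opE k x)))
  (if k = j then opH k x else nc_zero)"
proof
  fix v
  show "opE k (opF j x) v = nc_add (nc_smult (qpow (betaij k j)) (opF j (opE k x)))
    (if k = j then opH k x else nc_zero) v"
  proof (cases v)
    \<comment> \<open>On the coefficient of the empty word both K-terms of \<open>opH\<close> act by
      1 and cancel. Highest weight 0 makes this compatible with the value 0 of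
      \<open>opE_coeff\<close> there.\<close>
    case Nil
    then show ?thesis
      by (simp add: opE_def nc_add_def nc_smult_def nc_gen_mult_Nil nc_zero_def opH_def nc_diff_def
          opK_def wt_Nil)
  next
    case (Cons a u)
    have "(\<lambda>w. opF j x (b # w)) = (if b = j then x else nc_zero)" for b
      by (simp add: nc_gen_mult_Cons fun_eq_iff nc_zero_def)
    moreover have "opE_coeff i u nc_zero = 0" for i
      using opE_linear(4)[of i] by (metis opE_def nc_zero_def)
    moreover have "nc_zero u = (0 :: qrat)" for u :: "int list"
      by (simp add: nc_zero_def)
    ultimately show ?thesis
      using Cons by (simp add: opE_def nc_add_def nc_smult_def nc_gen_mult_Cons opH_linear)
  qed
qed

lemma opK_opE: "opK l (opE k x) = nc_smult (qpow (pair_coroot l k)) (opE k (opK l x))"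
proof -
  have "qpow (- wt l v) * opE_coeff k v x = qpow (pair_coroot l k) * opE_coeff k v (opK l x)" for v
  proof (induction v arbitrary: x)
    case (Cons j v)
    have shift: "(\<lambda>w. opK l x (a # w)) = nc_smult (qpow (- pair_coroot l a)) (opK l (\<lambda>w. x (a # w)))" for a
      by (simp add: opK_def nc_smult_def wt_Cons mult.assoc[symmetric] qpow_add[symmetric])
    have comm: "opH k (opK l y) = opK l (opH k y)" for y
      by (simp add: opH_def opK_linear opK_opK add.commute)
    have "opE_coeff k (j # v) (opK l x)
      = qpow (- pair_coroot l j) * qpow (betaij k j) * opE_coeff k v (opK l (\<lambda>w. x (j # w)))
        + qpow (- pair_coroot l k) * qpow (- wt l (j # v)) * opH k (\<lambda>w. x (k # w)) (j # v)"
      by (simp add: shift opE_coeff_smult opH_linear comm) (simp add: nc_smult_def opK_def)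
    \<comment> \<open>E_k deletes a letter k, and the prefactor in the claim restores the weight
      factor of that letter.\<close>
    moreover have "qpow (pair_coroot l k) * qpow (- pair_coroot l k) = 1"
      by (simp add: qpow_add[symmetric] qpow_zero)
    ultimately have "qpow (pair_coroot l k) * opE_coeff k (j # v) (opK l x)
      = qpow (- pair_coroot l j) * qpow (betaij k j) * (qpow (pair_coroot l k) * opE_coeff k v (opK l (\<lambda>w. x (j # w))))
        + qpow (- wt l (j # v)) * opH k (\<lambda>w. x (k # w)) (j # v)"
      by algebra
    also have "\<dots> = qpow (- wt l (j # v)) * opE_coeff k (j # v) x"
      by (simp only: Cons.IH[symmetric] opE_coeff.simps)
        (simp add: wt_Cons algebra_simps qpow_add[of "- pair_coroot l j" "- wt l v", simplified])
    finally show ?case by simp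
  qed simp
  then show ?thesis
    by (simp add: opK_def[of l "\<lambda>v. opE_coeff k v x"] opE_def nc_smult_def)
qed

lemma nc_smult_qpow_qpow: "nc_smult (qpow m) (nc_smult (qpow n) x) = nc_smult (qpow (m + n)) x"
  by (simp add: nc_smult_smult qpow_add)

lemma nc_smult_qpow_zero: "nc_smult (qpow 0) x = x"
  by (simp add: qpow_zero nc_smult_one)

lemma nc_smult_commute: "nc_smult c (nc_smult d x) = nc_smult d (nc_smult c x)"
  by (simp add: nc_smult_smult mult.commute)

lemma nc_zero_add: "nc_add x nc_zero = x" "nc_smult c nc_zero = nc_zero"
  by (simp_all add: nc_add_def nc_zero_def nc_smult_def)

text \<open>The scalar [2] is split into powers of q, so that normal forms contain no other coefficient.\<close>

definition serre_op :: "int \<Rightarrow> (elpoly \<Rightarrow> elpoly) \<Rightarrow> (elpoly \<Rightarrow> elpoly) \<Rightarrow> elpoly \<Rightarrow> elpoly" where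
  "serre_op c f g x = nc_add (nc_diff (nc_smult (qpow c) (f (f (g x))))
      (nc_add (nc_smult (qpow 1) (f (g (f x)))) (nc_smult (qpow (- 1)) (f (g (f x))))))
    (nc_smult (qpow (- c)) (g (f (f x))))"

lemma serre_expr_mult: "nc_mult (serre_expr c (nc_gen i) (nc_gen j)) x = serre_op c (opF i) (opF j) x"
  by (simp add: serre_expr_def nc_mult3_def serre_op_def nc_mult_linear nc_mult_assoc qtwo_eq
      nc_smult_add_scalar)

section \<open>Relators commute up to powers of q with the opposite generators\<close>

lemmas op_normalize = op_linear opE_opF opH_def opK_opF opK_opE pair_coroot_uminus pair_coroot_alpha
  cartan_def nc_smult_qpow_qpow nc_smult_qpow_zero nc_zero_add nc_add_zero_left qpow_zero nc_smult_one
  nc_smult_commute[of "inverse (qq - inverse qq)" "qpow _"]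

lemma opE_serre_opF_other:
  assumes "k \<noteq> i" "k \<noteq> j"
  shows "opE k (serre_op c (opF i) (opF j) x)
    = nc_smult (qpow (2 * betaij k i + betaij k j)) (serre_op c (opF i) (opF j) (opE k x))"
  using assms by (simp add: serre_op_def op_normalize add_ac)

text \<open>All terms containing the commutator of E_k and F_k cancel. What remains carries the
  exponent 2 beta_ki + beta_kj with j = i + 1, as for the other k: 3 for k = i, and 2 * (-3) for k =
  i + 1.\<close>

lemma opE_serre_opF_up:
  "opE i (serre_op 3 (opF i) (opF (i + 1)) x)
    = nc_smult (qpow 3) (serre_op 3 (opF i) (opF (i + 1)) (opE i x))"
  "opE (i + 1) (serre_op 3 (opF i) (opF (i + 1)) x)
    = nc_smult (qpow (- 6)) (serre_op 3 (opF i) (opF (i + 1)) (opE (i + 1) x))"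
  using betaij_down[of "i + 1"]
  by (simp_all add: serre_op_def op_normalize betaij_same betaij_up)
    (simp_all add: fun_eq_iff nc_add_def nc_diff_def algebra_simps)

lemma opE_serre_opF_down:
  "opE i (serre_op (- 3) (opF i) (opF (i - 1)) x)
    = nc_smult (qpow (- 3)) (serre_op (- 3) (opF i) (opF (i - 1)) (opE i x))"
  "opE (i - 1) (serre_op (- 3) (opF i) (opF (i - 1)) x)
    = nc_smult (qpow 6) (serre_op (- 3) (opF i) (opF (i - 1)) (opE (i - 1) x))"
  using betaij_up[of "i - 1"]
  by (simp_all add: serre_op_def op_normalize betaij_same betaij_down)
    (simp_all add: fun_eq_iff nc_add_def nc_diff_def algebra_simps)

text \<open>The mirror image, with E and F exchanged, serves another purpose: it propagates the
  vanishing of the Serre operator in the E from a vector to its image under F_k.\<close>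

lemma serre_opE_opF_other:
  assumes "i \<noteq> k" "j \<noteq> k"
  shows "serre_op c (opE i) (opE j) (opF k x)
    = nc_smult (qpow (2 * betaij i k + betaij j k)) (opF k (serre_op c (opE i) (opE j) x))"
  using assms by (simp add: serre_op_def op_normalize add_ac)

lemma serre_opE_opF_up:
  "serre_op 3 (opE i) (opE (i + 1)) (opF i x)
    = nc_smult (qpow (- 3)) (opF i (serre_op 3 (opE i) (opE (i + 1)) x))"
  "serre_op 3 (opE i) (opE (i + 1)) (opF (i + 1) x)
    = nc_smult (qpow 6) (opF (i + 1) (serre_op 3 (opE i) (opE (i + 1)) x))"
  using betaij_down[of "i + 1"]
  by (simp_all add: serre_op_def op_normalize betaij_same betaij_up)
    (simp_all add: fun_eq_iff nc_add_def nc_diff_def algebra_simps)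

lemma serre_opE_opF_down:
  "serre_op (- 3) (opE i) (opE (i - 1)) (opF i x)
    = nc_smult (qpow 3) (opF i (serre_op (- 3) (opE i) (opE (i - 1)) x))"
  "serre_op (- 3) (opE i) (opE (i - 1)) (opF (i - 1) x)
    = nc_smult (qpow (- 6)) (opF (i - 1) (serre_op (- 3) (opE i) (opE (i - 1)) x))"
  using betaij_up[of "i - 1"]
  by (simp_all add: serre_op_def op_normalize betaij_same betaij_down)
    (simp_all add: fun_eq_iff nc_add_def nc_diff_def algebra_simps)

definition far_op :: "int \<Rightarrow> (elpoly \<Rightarrow> elpoly) \<Rightarrow> (elpoly \<Rightarrow> elpoly) \<Rightarrow> elpoly \<Rightarrow> elpoly" where
  "far_op b f g x = nc_diff (f (g x)) (nc_smult (qpow b) (g (f x)))"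

lemma betaij_far': "\<bar>i - j\<bar> > 1 \<Longrightarrow> betaij j i = bij i j"
  using betaij_far[of j i] bij_far[of i j] bij_far[of j i] by auto

lemma far_mult:
  "nc_mult (nc_diff (nc_mult (nc_gen i) (nc_gen j)) (nc_smult (qpow b) (nc_mult (nc_gen j) (nc_gen i)))) x
    = far_op b (opF i) (opF j) x"
  by (simp add: far_op_def nc_mult_linear nc_mult_assoc)

text \<open>For k = i or k = j one commutator term arises from each of the two products. The two
  cancel because \<open>betaij\<close> is -b_ij in one order and b_ij in the other, and because
  K_(alpha_k) commutes with the remaining F.\<close>

lemma opE_far_opF:
  assumes "\<bar>i - j\<bar> > 1"
  shows "opE k (far_op (bij i j) (opF i) (opF j) x)
    = nc_smult (qpow (betaij k i + betaij k j)) (far_op (bij i j) (opF i) (opF j) (opE k x))"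
proof -
  consider "k = i" "k \<noteq> j" | "k = j" "k \<noteq> i" | "k \<noteq> i" "k \<noteq> j" using assms by fastforce
  moreover have "\<bar>i - j\<bar> \<noteq> 1" "\<bar>j - i\<bar> \<noteq> 1" using assms by auto
  ultimately show ?thesis
    by cases (simp_all add: far_op_def op_normalize betaij_same betaij_far[OF assms] betaij_far'[OF assms],
      simp_all add: fun_eq_iff nc_add_def nc_diff_def algebra_simps)
qed

lemma far_opE_opF:
  assumes "\<bar>i - j\<bar> > 1"
  shows "far_op (bij i j) (opE i) (opE j) (opF k x)
    = nc_smult (qpow (betaij i k + betaij j k)) (opF k (far_op (bij i j) (opE i) (opE j) x))"
proof -
  consider "k = i" "j \<noteq> k" | "k = j" "i \<noteq> k" | "i \<noteq> k" "j \<noteq> k" using assms by fastforce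
  moreover have "\<bar>i - j\<bar> \<noteq> 1" "\<bar>j - i\<bar> \<noteq> 1" using assms by auto
  ultimately show ?thesis
    by cases (simp_all add: far_op_def op_normalize betaij_same betaij_far[OF assms] betaij_far'[OF assms],
      simp_all add: fun_eq_iff nc_add_def nc_diff_def algebra_simps)
qed

section \<open>The relations among the E hold exactly on finitely supported vectors\<close>

lemma opE_vacuum: "opE k (nc_word []) = nc_zero"
proof
  show "opE k (nc_word []) v = nc_zero v" for v
  proof (cases v)
    case (Cons j u)
    have "(\<lambda>w. nc_word [] (a # w)) = (nc_zero :: elpoly)" for a
      by (simp add: nc_word_def nc_zero_def)
    then show ?thesis
      using Cons opE_linear(4)[of k]
      by (simp add: opE_def opH_linear) (simp add: nc_zero_def fun_eq_iff)
  qed (simp add: opE_def nc_zero_def)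
qed

text \<open>Every finitely supported vector is a combination of words, and every word arises from
  the empty one by left multiplications. The relations among the E therefore need no passage to a
  quotient, unlike those among the F.\<close>

lemma linear_vanish:
  assumes "nc_poly x"
    and add: "\<And>y z. T (nc_add y z) = nc_add (T y) (T z)"
    and smult: "\<And>c y. T (nc_smult c y) = nc_smult c (T y)"
    and vacuum: "T (nc_word []) = nc_zero"
    and gen: "\<And>k y. T y = nc_zero \<Longrightarrow> T (nc_mult (nc_gen k) y) = nc_zero"
  shows "T x = nc_zero"
proof -
  have word: "T (nc_word w) = nc_zero" for w
    by (induction w) (simp_all add: vacuum gen nc_gen_mult_word[symmetric])
  have zero: "T nc_zero = nc_zero"
    using smult[of 0 "nc_zero"] by (simp add: nc_smult_def nc_zero_def)
  from assms(1) show ?thesis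
    by (induction x rule: nc_poly_induct)
      (simp_all add: zero add smult word nc_zero_add)
qed

lemma serre_opE_linear:
  "serre_op c (opE i) (opE j) (nc_add x y) = nc_add (serre_op c (opE i) (opE j) x) (serre_op c (opE i) (opE j) y)"
  "serre_op c (opE i) (opE j) (nc_smult d x) = nc_smult d (serre_op c (opE i) (opE j) x)"
  by (simp_all add: serre_op_def op_linear)
    (simp_all add: fun_eq_iff nc_add_def nc_diff_def nc_smult_def algebra_simps)

lemma serre_opE_up:
  assumes "nc_poly x"
  shows "serre_op 3 (opE i) (opE (i + 1)) x = nc_zero"
  using assms
proof (rule linear_vanish)
  fix k y
  assume "serre_op 3 (opE i) (opE (i + 1)) y = nc_zero"
  then show "serre_op 3 (opE i) (opE (i + 1)) (opF k y) = nc_zero"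
    using serre_opE_opF_up[of i y] serre_opE_opF_other[of i k "i + 1" 3 y]
    by (cases "k = i \<or> k = i + 1") (auto simp: op_linear nc_zero_add)
qed (simp_all add: serre_opE_linear, simp add: serre_op_def opE_vacuum opE_linear nc_zero_add nc_diff_zero_right)

lemma serre_opE_down:
  assumes "nc_poly x"
  shows "serre_op (- 3) (opE i) (opE (i - 1)) x = nc_zero"
  using assms
proof (rule linear_vanish)
  fix k y
  assume "serre_op (- 3) (opE i) (opE (i - 1)) y = nc_zero"
  then show "serre_op (- 3) (opE i) (opE (i - 1)) (opF k y) = nc_zero"
    using serre_opE_opF_down[of i y] serre_opE_opF_other[of i k "i - 1" "- 3" y]
    by (cases "k = i \<or> k = i - 1") (auto simp: op_linear nc_zero_add)
qed (simp_all add: serre_opE_linear, simp add: serre_op_def opE_vacuum opE_linear nc_zero_add nc_diff_zero_right)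

lemma far_opE:
  assumes "\<bar>i - j\<bar> > 1" "nc_poly x"
  shows "far_op (bij i j) (opE i) (opE j) x = nc_zero"
  using assms(2)
proof (rule linear_vanish)
  fix k y
  assume "far_op (bij i j) (opE i) (opE j) y = nc_zero"
  then show "far_op (bij i j) (opE i) (opE j) (opF k y) = nc_zero"
    using far_opE_opF[OF assms(1), of k y] by (simp add: op_linear nc_zero_add)
qed (simp_all add: far_op_def op_linear opE_vacuum nc_zero_add nc_diff_zero_right,
  simp_all add: fun_eq_iff nc_add_def nc_diff_def nc_smult_def algebra_simps)

lemma nc_poly_opK [simp]: "nc_poly x \<Longrightarrow> nc_poly (opK l x)"
  unfolding nc_poly_def by (rule finite_subset[of _ "{w. x w \<noteq> 0}"]) (auto simp: opK_def)

lemma nc_poly_opH [simp]: "nc_poly x \<Longrightarrow> nc_poly (opH k x)"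
  by (simp add: opH_def)

lemma nc_poly_opE [simp]: "nc_poly x \<Longrightarrow> nc_poly (opE k x)"
proof (induction x rule: nc_poly_induct)
  case (step c w p)
  have "nc_poly (opE k (nc_word w))"
    by (induction w) (simp_all add: opE_vacuum nc_gen_mult_word[symmetric] opE_opF)
  with step show ?case by (simp add: opE_linear)
qed (simp add: opE_linear)

section \<open>The action of U on the Verma module\<close>

text \<open>The relators among the F, written in the generators of El: they are exactly the parts of
  highest degree of the relators of El.\<close>

definition minus_rels :: "elpoly set" where
  "minus_rels =
     {nc_diff (nc_mult (nc_gen i) (nc_gen j)) (nc_smult (qpow (bij i j)) (nc_mult (nc_gen j) (nc_gen i)))
       | i j. \<bar>i - j\<bar> > 1}
   \<union> {serre_expr 3 (nc_gen i) (nc_gen (i + 1)) | i. True}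
   \<union> {serre_expr (-3) (nc_gen i) (nc_gen (i - 1)) | i. True}"

lemma minus_rels_cases [consumes 1, case_names far up down]:
  assumes "r \<in> minus_rels"
  obtains i j where "\<bar>i - j\<bar> > 1" "r = nc_diff (nc_mult (nc_gen i) (nc_gen j))
      (nc_smult (qpow (bij i j)) (nc_mult (nc_gen j) (nc_gen i)))"
    | i where "r = serre_expr 3 (nc_gen i) (nc_gen (i + 1))"
    | i where "r = serre_expr (-3) (nc_gen i) (nc_gen (i - 1))"
  using assms unfolding minus_rels_def by blast

lemma nc_poly_minus_rels: "r \<in> minus_rels \<Longrightarrow> nc_poly r"
  by (auto elim!: minus_rels_cases)

text \<open>As a left ideal, the two-sided ideal is generated by relators times words. Left factors
  can then be added one generator at a time, which suits operators known through their commutation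
  with such a factor.\<close>

lemma nc_ideal_left_induct [consumes 1, case_names poly zero add smult rel gen]:
  assumes "a \<in> nc_ideal R" and R: "\<And>r. r \<in> R \<Longrightarrow> nc_poly r"
    and zero: "P nc_zero"
    and add: "\<And>x y. P x \<Longrightarrow> P y \<Longrightarrow> P (nc_add x y)"
    and smult: "\<And>c x. P x \<Longrightarrow> P (nc_smult c x)"
    and rel: "\<And>r v. r \<in> R \<Longrightarrow> P (nc_mult r (nc_word v))"
    and gen: "\<And>g x. P x \<Longrightarrow> P (nc_mult (nc_gen g) x)"
  shows "P a"
proof -
  have poly: "P (nc_mult p x)" if "nc_poly p" "P x" for p x
    using that(1)
  proof (induction p rule: nc_poly_induct)
    case (step c w p)
    have "P (nc_mult (nc_word w) x)"
      by (induction w) (simp_all add: that(2) gen nc_one_eq_word[symmetric] nc_mult_one_left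
          nc_gen_mult_word[symmetric] nc_mult_assoc)
    with step show ?case by (simp add: nc_mult_linear add smult)
  qed (simp add: nc_mult_zero_left zero)
  have "\<forall>s. nc_poly s \<longrightarrow> P (nc_mult a s)"
    using assms(1)
  proof (induction rule: nc_ideal.induct)
    case (gen r)
    have "P (nc_mult r s)" if "nc_poly s" for s
      using that
      by (induction s rule: nc_poly_induct)
        (simp_all add: nc_mult_linear zero add smult rel[OF gen])
    then show ?case by blast
  next
    case (mult a p s)
    then show ?case using poly[OF mult.hyps(2)] by (simp add: nc_mult_assoc)
  qed (simp_all add: nc_mult_linear zero add)
  then show ?thesis using nc_mult_one_right[of a] by (metis nc_poly_one)
qed

text \<open>Each relator is homogeneous for the weight, so a relator times a word is an eigenvector
  of K.\<close>

lemma opK_minus_ideal: "x \<in> nc_ideal minus_rels \<Longrightarrow> opK l x \<in> nc_ideal minus_rels"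
proof (induction x rule: nc_ideal_left_induct)
  case (rel r v)
  have word: "opK l (nc_word v) = nc_smult (qpow (- wt l v)) (nc_word v)" for v
    by (auto simp: opK_def nc_smult_def nc_word_def)
  have "\<exists>n. opK l (nc_mult r (nc_word v)) = nc_smult (qpow n) (nc_mult r (nc_word v))"
    using rel
  proof (cases rule: minus_rels_cases)
    case (far i j)
    then show ?thesis
      by (intro exI[of _ "- pair_coroot l i - pair_coroot l j - wt l v"])
        (simp add: far_mult, simp add: far_op_def op_linear opK_opF word nc_smult_qpow_qpow algebra_simps)
  next
    case (up i)
    then show ?thesis
      by (intro exI[of _ "- 2 * pair_coroot l i - pair_coroot l (i + 1) - wt l v"])
        (simp add: serre_expr_mult, simp add: serre_op_def op_linear opK_opF word nc_smult_qpow_qpow algebra_simps)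
  next
    case (down i)
    then show ?thesis
      by (intro exI[of _ "- 2 * pair_coroot l i - pair_coroot l (i - 1) - wt l v"])
        (simp add: serre_expr_mult, simp add: serre_op_def op_linear opK_opF word nc_smult_qpow_qpow algebra_simps)
  qed
  moreover have "nc_mult r (nc_word v) \<in> nc_ideal minus_rels"
    using rel by (intro nc_ideal_mult_right nc_ideal.gen nc_poly_word)
  ultimately show ?case by (auto intro: nc_ideal_smult)
qed (auto simp: nc_poly_minus_rels opK_linear opK_opF nc_ideal.zero intro!: nc_ideal.add nc_ideal_smult nc_ideal_mult_left)

lemma opH_minus_ideal: "x \<in> nc_ideal minus_rels \<Longrightarrow> opH l x \<in> nc_ideal minus_rels"
  by (simp add: opH_def nc_ideal_smult nc_ideal_diff opK_minus_ideal)

lemma opE_minus_ideal: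
  assumes "x \<in> nc_ideal minus_rels"
  shows "opE k x \<in> nc_ideal minus_rels"
proof -
  \<comment> \<open>Membership of x itself is carried along: when a letter k is put in front of x,
    E_k produces the extra term \<open>opH k x\<close>.\<close>
  have "x \<in> nc_ideal minus_rels \<and> opE k x \<in> nc_ideal minus_rels"
    using assms
  proof (induction x rule: nc_ideal_left_induct)
    case (rel r v)
    have mem: "nc_mult r s \<in> nc_ideal minus_rels" if "nc_poly s" for s
      using rel that by (intro nc_ideal_mult_right nc_ideal.gen)
    have "\<exists>n. opE k (nc_mult r x) = nc_smult (qpow n) (nc_mult r (opE k x))" for x
      using rel
    proof (cases rule: minus_rels_cases)
      case (far i j)
      then show ?thesis using opE_far_opF[of i j k] by (simp add: far_mult) blast
    next
      case (up i)
      then show ?thesis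
        using opE_serre_opF_up[of i] opE_serre_opF_other[of k i "i + 1" 3]
        by (cases "k = i \<or> k = i + 1") (auto simp: serre_expr_mult)
    next
      case (down i)
      then show ?thesis
        using opE_serre_opF_down[of i] opE_serre_opF_other[of k i "i - 1" "- 3"]
        by (cases "k = i \<or> k = i - 1") (auto simp: serre_expr_mult)
    qed
    then obtain n where "opE k (nc_mult r (nc_word v)) = nc_smult (qpow n) (nc_mult r (opE k (nc_word v)))"
      by blast
    then show ?case
      by (simp add: mem nc_ideal_smult)
  qed (auto simp: nc_poly_minus_rels opE_linear opE_opF nc_ideal.zero opH_minus_ideal
      intro!: nc_ideal.add nc_ideal_smult nc_ideal_mult_left)
  then show ?thesis ..
qed

primrec op_gen :: "ugen \<Rightarrow> elpoly \<Rightarrow> elpoly" where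
  "op_gen (UE i) = opE i"
| "op_gen (UF i) = opF i"
| "op_gen (UK l) = opK l"

definition act :: "upoly \<Rightarrow> elpoly \<Rightarrow> elpoly" where
  "act p x = lin_ext (\<lambda>w. foldr op_gen w x) p"

lemma op_gen_linear:
  "op_gen g (nc_add x y) = nc_add (op_gen g x) (op_gen g y)"
  "op_gen g (nc_smult c x) = nc_smult c (op_gen g x)"
  "op_gen g nc_zero = nc_zero"
  by (cases g; simp add: op_linear)+

lemma foldr_op_gen_linear:
  "foldr op_gen w (nc_add x y) = nc_add (foldr op_gen w x) (foldr op_gen w y)"
  "foldr op_gen w (nc_smult c x) = nc_smult c (foldr op_gen w x)"
  "foldr op_gen w nc_zero = nc_zero"
  by (induction w) (simp_all add: op_gen_linear)

lemma act_zero: "act nc_zero x = nc_zero"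
  by (simp add: act_def lin_ext_zero)

lemma act_word: "act (nc_word w) x = foldr op_gen w x"
  by (simp add: act_def lin_ext_word)

lemma act_one: "act nc_one x = x"
  by (simp add: nc_one_eq_word act_word)

lemma act_gen: "act (nc_gen g) x = op_gen g x"
  by (simp add: nc_gen_eq_word act_word)

lemma act_add: "nc_poly p \<Longrightarrow> nc_poly q \<Longrightarrow> act (nc_add p q) x = nc_add (act p x) (act q x)"
  by (simp add: act_def lin_ext_add)

lemma act_smult: "nc_poly p \<Longrightarrow> act (nc_smult c p) x = nc_smult c (act p x)"
  by (simp add: act_def lin_ext_smult)

lemma act_diff: "nc_poly p \<Longrightarrow> nc_poly q \<Longrightarrow> act (nc_diff p q) x = nc_diff (act p x) (act q x)"
  by (simp add: nc_diff_conv_add act_add act_smult)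

lemma act_mult:
  assumes "nc_poly p" "nc_poly q"
  shows "act (nc_mult p q) x = act p (act q x)"
proof -
  have word: "act (nc_mult (nc_word u) q) x = act (nc_word u) (act q x)" for u
    using assms(2)
    by (induction q rule: nc_poly_induct)
      (simp_all add: nc_mult_linear act_zero act_add act_smult nc_word_mult_word act_word
        foldr_op_gen_linear)
  show ?thesis
    using assms(1)
    by (induction p rule: nc_poly_induct)
      (simp_all add: nc_mult_linear act_zero act_add act_smult word assms(2))
qed

lemmas act_simps = act_zero act_one act_gen act_add act_smult act_diff act_mult

lemma act_serre:
  "act (serre_expr c (nc_gen a) (nc_gen b)) x = serre_op c (op_gen a) (op_gen b) x"
  by (simp add: serre_expr_def nc_mult3_def act_simps serre_op_def qtwo_eq nc_smult_add_scalar)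

lemma nc_poly_op_gen: "nc_poly x \<Longrightarrow> nc_poly (op_gen g x)"
  by (cases g) simp_all

lemma nc_poly_act [simp]:
  assumes "nc_poly p" "nc_poly x"
  shows "nc_poly (act p x)"
proof -
  have "nc_poly (foldr op_gen w x)" for w
    by (induction w) (simp_all add: assms(2) nc_poly_op_gen)
  note word = this
  show ?thesis
    using assms(1)
    by (induction p rule: nc_poly_induct) (simp_all add: act_simps act_word word)
qed

lemma act_minus_ideal:
  assumes "nc_poly p" and x: "x \<in> nc_ideal minus_rels"
  shows "act p x \<in> nc_ideal minus_rels"
proof -
  have gen: "op_gen g y \<in> nc_ideal minus_rels" if "y \<in> nc_ideal minus_rels" for g y
    using that by (cases g) (simp_all add: opE_minus_ideal opK_minus_ideal nc_ideal_mult_left)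
  have word: "foldr op_gen w x \<in> nc_ideal minus_rels" for w
    by (induction w) (simp_all add: x gen)
  show ?thesis
    using assms(1)
    by (induction p rule: nc_poly_induct)
      (simp_all add: act_simps act_word word nc_ideal.zero nc_ideal.add nc_ideal_smult)
qed

lemma minus_rels_mem:
  "\<bar>i - j\<bar> > 1 \<Longrightarrow> nc_diff (nc_mult (nc_gen i) (nc_gen j))
      (nc_smult (qpow (bij i j)) (nc_mult (nc_gen j) (nc_gen i))) \<in> minus_rels"
  "serre_expr 3 (nc_gen i) (nc_gen (i + 1)) \<in> minus_rels"
  "serre_expr (- 3) (nc_gen i) (nc_gen (i - 1)) \<in> minus_rels"
  unfolding minus_rels_def by blast+

lemma U_rels_cases:
  assumes "r \<in> U_rels"
  obtains l m where "r = nc_diff (nc_mult (gK l) (gK m)) (gK (\<lambda>j. l j + m j))"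
    | "r = nc_diff (gK (\<lambda>j. 0)) nc_one"
    | l i where "r = nc_diff (nc_mult (gK l) (gF i))
        (nc_smult (qpow (- pair_coroot l i)) (nc_mult (gF i) (gK l)))"
    | l i where "r = nc_diff (nc_mult (gK l) (gE i))
        (nc_smult (qpow (pair_coroot l i)) (nc_mult (gE i) (gK l)))"
    | i j where "r = nc_diff (nc_diff (nc_mult (gE i) (gF j))
          (nc_smult (qpow (betaij i j)) (nc_mult (gF j) (gE i))))
        (if i = j then nc_smult (inverse (qq - inverse qq)) (nc_diff (gK (alpha i)) (gK (\<lambda>k. - alpha i k)))
          else nc_zero)"
    | i j where "\<bar>i - j\<bar> > 1"
        "r = nc_diff (nc_mult (gF i) (gF j)) (nc_smult (qpow (bij i j)) (nc_mult (gF j) (gF i)))"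
    | i j where "\<bar>i - j\<bar> > 1"
        "r = nc_diff (nc_mult (gE i) (gE j)) (nc_smult (qpow (bij i j)) (nc_mult (gE j) (gE i)))"
    | i where "r = serre_expr 3 (gF i) (gF (i + 1))"
    | i where "r = serre_expr (-3) (gF i) (gF (i - 1))"
    | i where "r = serre_expr 3 (gE i) (gE (i + 1))"
    | i where "r = serre_expr (-3) (gE i) (gE (i - 1))"
  using assms unfolding U_rels_def Un_iff mem_Collect_eq insert_iff by (elim disjE exE conjE) blast+

lemma nc_diff_eq_zero_iff: "nc_diff x y = nc_zero \<longleftrightarrow> x = y"
  by (simp add: nc_diff_def nc_zero_def fun_eq_iff)

lemma act_U_rels:
  assumes "r \<in> U_rels" and x: "nc_poly x"
  shows "act r x \<in> nc_ideal minus_rels"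
proof -
  \<comment> \<open>Only the relators among the F act by something nonzero, namely by left
    multiplication with the corresponding element of \<open>minus_rels\<close>.\<close>
  have "act r x = nc_zero \<or> (\<exists>s\<in>minus_rels. act r x = nc_mult s x)"
    using assms(1)
  proof (cases rule: U_rels_cases)
    case (1 l m)
    then show ?thesis by (simp add: act_simps opK_opK nc_diff_eq_zero_iff)
  next
    case 2
    then show ?thesis by (simp add: act_simps opK_zero nc_diff_eq_zero_iff)
  next
    case (3 l i)
    then show ?thesis by (simp add: act_simps opK_opF nc_diff_eq_zero_iff)
  next
    case (4 l i)
    then show ?thesis by (simp add: act_simps opK_opE nc_diff_eq_zero_iff)
  next
    case (5 i j)
    then show ?thesis
      by (simp add: act_simps opE_opF opH_def)
        (auto simp: nc_add_def nc_diff_def nc_zero_def)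
  next
    case (6 i j)
    then have "act r x = nc_mult (nc_diff (nc_mult (nc_gen i) (nc_gen j))
        (nc_smult (qpow (bij i j)) (nc_mult (nc_gen j) (nc_gen i)))) x"
      by (simp add: act_simps far_mult) (simp add: far_op_def)
    then show ?thesis using minus_rels_mem(1)[OF 6(1)] by blast
  next
    case (7 i j)
    then have "act r x = nc_zero"
      using far_opE[OF 7(1) x] by (simp add: act_simps far_op_def)
    then show ?thesis ..
  next
    case (8 i)
    then have "act r x = nc_mult (serre_expr 3 (nc_gen i) (nc_gen (i + 1))) x"
      by (simp add: act_serre serre_expr_mult)
    then show ?thesis using minus_rels_mem(2) by blast
  next
    case (9 i)
    then have "act r x = nc_mult (serre_expr (- 3) (nc_gen i) (nc_gen (i - 1))) x"
      by (simp add: act_serre serre_expr_mult)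
    then show ?thesis using minus_rels_mem(3) by blast
  next
    case (10 i)
    then show ?thesis using serre_opE_up[OF x, of i] by (simp add: act_serre)
  next
    case (11 i)
    then show ?thesis using serre_opE_down[OF x, of i] by (simp add: act_serre)
  qed
  then show ?thesis
    using nc_ideal_mult_right[OF nc_ideal.gen x, of _ minus_rels] nc_ideal.zero by auto
qed

lemma nc_poly_U_rels: "r \<in> U_rels \<Longrightarrow> nc_poly r"
  using nc_poly_relators[where 'a = ugen] by (simp add: relators_ugen_def)

text \<open>In a product p a s, the factor s replaces x by another vector, a sends that vector into
  J, and p preserves J; hence the induction over all x.\<close>

lemma act_U_ideal: "a \<in> nc_ideal U_rels \<Longrightarrow> nc_poly x \<Longrightarrow> act a x \<in> nc_ideal minus_rels"
proof (induction arbitrary: x rule: nc_ideal.induct)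
  case (add a b)
  then show ?case
    by (simp add: act_add nc_ideal_poly[OF _ nc_poly_U_rels] nc_ideal.add)
next
  case (mult a p s)
  then show ?case
    by (simp add: act_mult nc_ideal_poly[OF _ nc_poly_U_rels] act_minus_ideal)
qed (simp_all add: act_zero nc_ideal.zero act_U_rels)

section \<open>Leading terms\<close>

text \<open>The bound is strict so that n = 0 describes the zero polynomial, the start of the
  induction on the degree.\<close>

definition deg_lt :: "nat \<Rightarrow> ('g list \<Rightarrow> 'k::comm_ring_1) \<Rightarrow> bool" where
  "deg_lt n p \<longleftrightarrow> (\<forall>w. p w \<noteq> 0 \<longrightarrow> length w < n)"

definition hom_part :: "nat \<Rightarrow> ('g list \<Rightarrow> 'k::comm_ring_1) \<Rightarrow> 'g list \<Rightarrow> 'k" where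
  "hom_part n p = (\<lambda>w. if length w = n then p w else 0)"

lemma deg_lt_zero [simp]: "deg_lt n nc_zero"
  by (simp add: deg_lt_def nc_zero_def)

lemma deg_lt_add: "deg_lt n p \<Longrightarrow> deg_lt n q \<Longrightarrow> deg_lt n (nc_add p q)"
  unfolding deg_lt_def nc_add_def by (metis add_0)

lemma deg_lt_smult: "deg_lt n p \<Longrightarrow> deg_lt n (nc_smult c p)"
  unfolding deg_lt_def nc_smult_def by (metis mult_zero_right)

lemma deg_lt_mono: "deg_lt m p \<Longrightarrow> m \<le> n \<Longrightarrow> deg_lt n p"
  unfolding deg_lt_def by (meson less_le_trans)

lemma deg_lt_word: "length w < n \<Longrightarrow> deg_lt n (nc_word w)"
  by (simp add: deg_lt_def nc_word_def)

lemma deg_lt_gen_mult: "deg_lt n p \<Longrightarrow> deg_lt (Suc n) (nc_mult (nc_gen g) p)"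
  unfolding deg_lt_def
proof (intro allI impI)
  fix w
  assume "\<forall>w. p w \<noteq> 0 \<longrightarrow> length w < n" "nc_mult (nc_gen g) p w \<noteq> 0"
  then show "length w < Suc n"
    by (cases w) (auto simp: nc_gen_mult_Cons split: if_splits)
qed

lemma hom_part_linear:
  "hom_part n (nc_add p q) = nc_add (hom_part n p) (hom_part n q)"
  "hom_part n (nc_smult c p) = nc_smult c (hom_part n p)"
  "hom_part n nc_zero = nc_zero"
  by (auto simp: hom_part_def nc_add_def nc_smult_def nc_zero_def)

lemma hom_part_gen_mult:
  "hom_part n (nc_mult (nc_gen g) p) = (case n of 0 \<Rightarrow> nc_zero | Suc m \<Rightarrow> nc_mult (nc_gen g) (hom_part m p))"
proof
  show "hom_part n (nc_mult (nc_gen g) p) w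
    = (case n of 0 \<Rightarrow> nc_zero | Suc m \<Rightarrow> nc_mult (nc_gen g) (hom_part m p)) w" for w
    by (cases w; cases n)
      (simp_all add: hom_part_def nc_gen_mult_Nil nc_gen_mult_Cons nc_zero_def)
qed

lemma nc_poly_hom_part [simp]: "nc_poly p \<Longrightarrow> nc_poly (hom_part n p)"
  unfolding nc_poly_def by (rule finite_subset[of _ "{w. p w \<noteq> 0}"]) (auto simp: hom_part_def)

lemma hom_part_word: "hom_part n (nc_word w) = (if n = length w then nc_word w else nc_zero)"
  by (auto simp: hom_part_def nc_word_def nc_zero_def)

section \<open>Comparison of J with the ideal of El\<close>

lemma El_rels_mem:
  "\<bar>i - j\<bar> > 1 \<Longrightarrow> nc_diff (nc_mult (nc_gen i) (nc_gen j))
      (nc_smult (qpow (bij i j)) (nc_mult (nc_gen j) (nc_gen i))) \<in> El_rels eps"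
  "nc_add (serre_expr 3 (nc_gen i) (nc_gen (i + 1))) (nc_smult (qpow eps * qtwo) (nc_gen i)) \<in> El_rels eps"
  "nc_add (serre_expr (-3) (nc_gen i) (nc_gen (i - 1))) (nc_smult (qpow eps * qtwo) (nc_gen i)) \<in> El_rels eps"
  unfolding El_rels_def by blast+

text \<open>Equality in El to an element of degree less than \<open>n\<close>.\<close>

definition lowerable :: "int \<Rightarrow> nat \<Rightarrow> elpoly \<Rightarrow> bool" where
  "lowerable eps n p \<longleftrightarrow> (\<exists>b. nc_poly b \<and> deg_lt n b \<and> nc_diff p b \<in> nc_ideal (El_rels eps))"

lemma lowerable_zero: "lowerable eps n nc_zero"
  unfolding lowerable_def
  by (rule exI[of _ nc_zero]) (simp add: nc_diff_zero_right nc_ideal.zero)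

lemma lowerable_add:
  assumes "lowerable eps n p" "lowerable eps n q"
  shows "lowerable eps n (nc_add p q)"
proof -
  obtain b c where "nc_poly b" "deg_lt n b" "nc_diff p b \<in> nc_ideal (El_rels eps)"
    "nc_poly c" "deg_lt n c" "nc_diff q c \<in> nc_ideal (El_rels eps)"
    using assms by (auto simp: lowerable_def)
  moreover have "nc_diff (nc_add p q) (nc_add b c) = nc_add (nc_diff p b) (nc_diff q c)"
    by (simp add: nc_diff_def nc_add_def algebra_simps)
  ultimately show ?thesis
    unfolding lowerable_def by (intro exI[of _ "nc_add b c"]) (simp add: deg_lt_add nc_ideal.add)
qed

lemma lowerable_smult:
  assumes "lowerable eps n p"
  shows "lowerable eps n (nc_smult c p)"
proof -
  obtain b where "nc_poly b" "deg_lt n b" "nc_diff p b \<in> nc_ideal (El_rels eps)"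
    using assms by (auto simp: lowerable_def)
  then show ?thesis
    unfolding lowerable_def
    by (intro exI[of _ "nc_smult c b"]) (simp add: deg_lt_smult nc_smult_diff[symmetric] nc_ideal_smult)
qed

lemma lowerable_gen_mult:
  assumes "lowerable eps n p"
  shows "lowerable eps (Suc n) (nc_mult (nc_gen g) p)"
proof -
  obtain b where "nc_poly b" "deg_lt n b" "nc_diff p b \<in> nc_ideal (El_rels eps)"
    using assms by (auto simp: lowerable_def)
  then show ?thesis
    unfolding lowerable_def
    by (intro exI[of _ "nc_mult (nc_gen g) b"])
      (simp add: deg_lt_gen_mult nc_mult_diff_right[symmetric] nc_ideal_mult_left)
qed

lemma lowerable_serre:
  assumes "nc_add (serre_expr c (nc_gen i) (nc_gen j)) (nc_smult d (nc_gen i)) \<in> El_rels eps"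
  shows "lowerable eps (3 + length v) (nc_mult (serre_expr c (nc_gen i) (nc_gen j)) (nc_word v))"
proof -
  \<comment> \<open>The inhomogeneous term of the relator times v; it has length 1 + |v|, two less
    than the Serre part.\<close>
  let ?b = "nc_smult (- d) (nc_word (i # v))"
  have "nc_mult (nc_add (serre_expr c (nc_gen i) (nc_gen j)) (nc_smult d (nc_gen i))) (nc_word v)
      \<in> nc_ideal (El_rels eps)"
    using assms by (intro nc_ideal_mult_right nc_ideal.gen) simp_all
  moreover have "nc_mult (nc_add (serre_expr c (nc_gen i) (nc_gen j)) (nc_smult d (nc_gen i))) (nc_word v)
    = nc_diff (nc_mult (serre_expr c (nc_gen i) (nc_gen j)) (nc_word v)) ?b"
    by (simp add: nc_mult_linear nc_gen_mult_word) (simp add: nc_add_def nc_diff_def nc_smult_def)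
  ultimately show ?thesis
    unfolding lowerable_def
    by (intro exI[of _ ?b]) (simp add: deg_lt_smult deg_lt_word)
qed

lemma hom_part_serre_word:
  fixes i j :: int
  shows "hom_part n (nc_mult (serre_expr c (nc_gen i) (nc_gen j)) (nc_word v))
    = (if n = 3 + length v then nc_mult (serre_expr c (nc_gen i) (nc_gen j)) (nc_word v) else nc_zero)"
  by (simp add: serre_expr_mult serre_op_def nc_gen_mult_word nc_diff_conv_add hom_part_linear hom_part_word
      nc_zero_add)

text \<open>The relators are homogeneous of degree 2 or 3, so a component of relator times word is
  the whole product or zero. A far relator vanishes in El as well, and a Serre relator equals a
  multiple of a single letter there.\<close>

lemma minus_ideal_hom_part_lowerable:
  assumes "a \<in> nc_ideal minus_rels"
  shows "lowerable eps n (hom_part n a)"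
proof -
  \<comment> \<open>The degree is generalised because a letter put in front shifts components by
    one.\<close>
  have "\<forall>n. lowerable eps n (hom_part n a)"
    using assms
  proof (induction a rule: nc_ideal_left_induct)
    case (rel r v)
    show ?case
      using rel
    proof (cases rule: minus_rels_cases)
      case (far i j)
      have "nc_mult r (nc_word v) \<in> nc_ideal (El_rels eps)"
        using El_rels_mem(1)[OF far(1), of eps] far(2)
        by (intro nc_ideal_mult_right nc_ideal.gen) simp_all
      then have "lowerable eps n (nc_mult r (nc_word v))" for n
        unfolding lowerable_def by (intro exI[of _ nc_zero]) (simp add: nc_diff_zero_right)
      moreover have "hom_part n (nc_mult r (nc_word v))
          = (if n = 2 + length v then nc_mult r (nc_word v) else nc_zero)" for n
        unfolding far(2) far_mult far_op_def
        by (simp add: nc_gen_mult_word nc_diff_conv_add hom_part_linear hom_part_word nc_zero_add)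
      ultimately show ?thesis by (simp add: lowerable_zero)
    next
      case (up i)
      then show ?thesis
        using lowerable_serre[OF El_rels_mem(2)[of i eps], of v]
        by (simp add: hom_part_serre_word lowerable_zero)
    next
      case (down i)
      then show ?thesis
        using lowerable_serre[OF El_rels_mem(3)[of i eps], of v]
        by (simp add: hom_part_serre_word lowerable_zero)
    qed
  qed (simp_all add: nc_poly_minus_rels hom_part_linear lowerable_zero lowerable_add lowerable_smult
      hom_part_gen_mult lowerable_gen_mult split: nat.split)
  then show ?thesis ..
qed

section \<open>Leading terms of j applied to the empty word\<close>

lemma deg_lt_opK: "deg_lt n x \<Longrightarrow> deg_lt n (opK l x)"
  by (simp add: deg_lt_def opK_def)

text \<open>A nonzero coefficient at v stems from a word one letter longer. The weaker bound stated
  suffices, since the competing summand F_i already gains a letter.\<close>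

lemma deg_lt_opE:
  assumes "deg_lt n x"
  shows "deg_lt n (opE k x)"
proof -
  have "\<exists>u. length u = Suc (length v) \<and> x u \<noteq> 0" if "opE_coeff k v x \<noteq> 0" for v
    using that
  proof (induction v arbitrary: x)
    case (Cons j v)
    show ?case
    proof (cases "opE_coeff k v (\<lambda>w. x (j # w)) = 0")
      case True
      then have "x (k # j # v) \<noteq> 0"
        using Cons.prems by (auto simp: opH_def nc_smult_def nc_diff_def opK_def)
      then show ?thesis by (intro exI[of _ "k # j # v"]) simp
    next
      case False
      from Cons.IH[OF this] show ?thesis by (metis length_Cons)
    qed
  qed simp
  then show ?thesis
    using assms unfolding deg_lt_def opE_def by (metis Suc_lessD)
qed

lemma act_nc_eval:
  assumes "nc_poly p" "\<And>i. nc_poly (f i)"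
  shows "act (nc_eval f p) x = lin_ext (\<lambda>w. foldr (\<lambda>i. act (f i)) w x) p"
proof -
  have poly: "nc_poly (nc_listprod (map f w))" for w
    using assms(2) by (intro nc_poly_listprod) auto
  have "act (nc_listprod (map f w)) x = foldr (\<lambda>i. act (f i)) w x" for w
    by (induction w) (use assms(2) poly in \<open>simp_all add: nc_listprod_def act_one act_mult\<close>)
  note word = this
  show ?thesis
    using assms(1)
    by (induction p rule: nc_poly_induct)
      (simp_all add: assms(2) poly word nc_eval_zero nc_eval_step lin_ext_simps act_simps)
qed

lemma act_jgen: "act (jgen eps i) x = nc_add (opF i x)
    (nc_smult (qpow (eps - 1)) (opE (i - 1) (opK (\<lambda>k. - alpha (i - 1) k) x)))"
  by (simp add: jgen_def act_simps)

lemma act_jgen_word_vacuum: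
  "\<exists>y. foldr (\<lambda>i. act (jgen eps i)) w (nc_word []) = nc_add (nc_word w) y \<and> deg_lt (length w) y"
proof (induction w)
  case Nil
  then show ?case by (intro exI[of _ nc_zero]) (simp add: nc_zero_add)
next
  case (Cons i w)
  then obtain y where y: "foldr (\<lambda>i. act (jgen eps i)) w (nc_word []) = nc_add (nc_word w) y"
    "deg_lt (length w) y" by blast
  let ?E = "\<lambda>x. nc_smult (qpow (eps - 1)) (opE (i - 1) (opK (\<lambda>k. - alpha (i - 1) k) x))"
  have E: "deg_lt n (?E x)" if "deg_lt n x" for n x
    using that by (intro deg_lt_smult deg_lt_opE deg_lt_opK)
  have wy: "deg_lt (Suc (length w)) (nc_add (nc_word w) y)"
    using y(2) by (intro deg_lt_add deg_lt_word) (auto intro: deg_lt_mono)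
  have "deg_lt (Suc (length w)) (nc_add (opF i y) (?E (nc_add (nc_word w) y)))"
    by (rule deg_lt_add[OF deg_lt_gen_mult[OF y(2)] E[OF wy]])
  moreover have "foldr (\<lambda>i. act (jgen eps i)) (i # w) (nc_word [])
    = nc_add (nc_word (i # w)) (nc_add (opF i y) (?E (nc_add (nc_word w) y)))"
    by (simp add: y(1) act_jgen nc_mult_add_right nc_gen_mult_word nc_add_assoc)
  ultimately show ?case by (metis length_Cons)
qed

lemma hom_part_act_vacuum:
  assumes "nc_poly p" "deg_lt (Suc n) p"
  shows "hom_part n (act (nc_eval (jgen eps) p) (nc_word [])) = hom_part n p"
proof
  fix v
  let ?X = "\<lambda>w. foldr (\<lambda>i. act (jgen eps i)) w (nc_word [])"
  have "act (nc_eval (jgen eps) p) (nc_word []) v = p v" if "length v = n"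
  proof -
    \<comment> \<open>Words of p have length at most n, and the correction to w involves only words
      shorter than w, so it vanishes at v, which has length n.\<close>
    have "?X w v = (if v = w then 1 else 0)" if "p w \<noteq> 0" for w
    proof -
      have "length w \<le> length v"
        using that assms(2) \<open>length v = n\<close> by (auto simp: deg_lt_def less_Suc_eq_le)
      moreover obtain y where "?X w = nc_add (nc_word w) y" "deg_lt (length w) y"
        using act_jgen_word_vacuum by blast
      ultimately show ?thesis
        by (auto simp: deg_lt_def nc_add_def nc_word_def)
    qed
    then have "act (nc_eval (jgen eps) p) (nc_word []) v
        = (\<Sum>w\<in>{w. p w \<noteq> 0}. p w * (if v = w then 1 else 0))"
      using assms(1) by (simp add: act_nc_eval lin_ext_def)
    also have "\<dots> = p v"
      using assms(1) by (simp add: nc_poly_def if_distrib sum.delta' cong: if_cong)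
    finally show ?thesis .
  qed
  then show "hom_part n (act (nc_eval (jgen eps) p) (nc_word [])) v = hom_part n p v"
    by (simp add: hom_part_def)
qed

section \<open>Descent on the degree\<close>

lemma nc_eval_jgen_injective:
  assumes "nc_poly p" "nc_eval (jgen eps) p \<in> nc_ideal U_rels"
  shows "p \<in> nc_ideal (El_rels eps)"
proof -
  have "p \<in> nc_ideal (El_rels eps)"
    if "nc_poly p" "nc_eval (jgen eps) p \<in> nc_ideal U_rels" "deg_lt n p" for n p
    using that
  proof (induction n arbitrary: p)
    case 0
    then have "p = nc_zero" by (auto simp: deg_lt_def nc_zero_def)
    then show ?case by (simp add: nc_ideal.zero)
  next
    case (Suc n)
    have "act (nc_eval (jgen eps) p) (nc_word []) \<in> nc_ideal minus_rels"
      using Suc.prems by (intro act_U_ideal) simp_all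
    then have "lowerable eps n (hom_part n p)"
      using minus_ideal_hom_part_lowerable hom_part_act_vacuum[OF Suc.prems(1,3)] by metis
    then obtain b where b: "nc_poly b" "deg_lt n b" "nc_diff (hom_part n p) b \<in> nc_ideal (El_rels eps)"
      by (auto simp: lowerable_def)
    \<comment> \<open>\<open>?d\<close> is the top component minus its substitute of lower degree,
      an element of the ideal of El; subtracting it removes all words of length n from p.\<close>
    let ?d = "nc_diff (hom_part n p) b" and ?p = "nc_add (nc_diff p (hom_part n p)) b"
    have eq: "?p = nc_diff p ?d" "p = nc_add ?p ?d"
      by (simp_all add: nc_diff_def nc_add_def algebra_simps)
    have poly: "nc_poly ?p" "nc_poly ?d"
      using Suc.prems b by simp_all
    have "deg_lt n (nc_diff p (hom_part n p))"
      using Suc.prems(3) by (auto simp: deg_lt_def nc_diff_def hom_part_def less_Suc_eq)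
    then have "deg_lt n ?p"
      using b by (intro deg_lt_add)
    \<comment> \<open>Well-definedness of j puts the image of \<open>?d\<close> into the ideal of U,
      so the hypothesis on p survives the subtraction.\<close>
    moreover have "nc_eval (jgen eps) ?p \<in> nc_ideal U_rels"
      using Suc.prems b poly(2) nc_eval_jgen_ideal[OF b(3)]
      by (simp add: eq(1) nc_eval_diff nc_ideal_diff)
    ultimately have "?p \<in> nc_ideal (El_rels eps)"
      using Suc.IH poly by blast
    then show ?case
      using b(3) by (subst eq(2)) (rule nc_ideal.add)
  qed
  moreover obtain n where "deg_lt n p"
  proof -
    have "finite (length ` {w. p w \<noteq> 0})"
      using assms(1) by (simp add: nc_poly_def)
    \<comment> \<open>For p = 0 the maximum is over the empty set, and the bound holds
      vacuously.\<close>
    then have "deg_lt (Suc (Max (length ` {w. p w \<noteq> 0}))) p"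
      by (auto simp: deg_lt_def less_Suc_eq_le)
    then show ?thesis by (rule that)
  qed
  ultimately show ?thesis using assms by blast
qed

theorem mainTheorem9:
  fixes eps :: int
  assumes "eps = 1 \<or> eps = -1"
  shows "(\<forall>p \<in> nc_ideal (El_rels eps). nc_eval (jgen eps) p \<in> nc_ideal U_rels)
       \<and> (\<forall>p :: elpoly. nc_poly p \<longrightarrow> nc_eval (jgen eps) p \<in> nc_ideal U_rels \<longrightarrow> p \<in> nc_ideal (El_rels eps))
       \<and> (\<forall>p :: elpoly. nc_poly p \<longrightarrow>
            (\<exists>t \<in> CU eps. nc_diff (Delta (nc_eval (jgen eps) p)) t \<in> nc_ideal UU_rels))
       \<and> (\<forall>i. nc_diff (Delta (jgen eps i))
                 (nc_add (tR (jgen eps i)) (nc_mult (tL (jgen eps i)) (nc_gen (Inr (UK (beta i))))))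
               \<in> nc_ideal UU_rels)"
  using nc_eval_jgen_ideal nc_eval_jgen_injective Delta_nc_eval_jgen_CU Delta_jgen by blast

end
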